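(* In the setting of the context ($\mathcal A=k[\hbar]/\hbar^2$; first-order quantizations $\mathcal O_\hbar(D)$, $\mathcal O_\hbar(G)$ of affine algebraic groups $D\supset G$, with $c$ nondegenerate and $\mathfrak g\subset\mathfrak d$ Lagrangian; an $\mathcal O_\hbar(G)$-comodule algebra $A_\hbar$ quantizing a $G$-variety $X$), suppose $\mu\colon X\to D/G$ is a $G$-equivariant map and $\mu_\hbar\colon\mathcal F\to A_\hbar$ is a quantum moment map which is $\mu^*$ modulo $\hbar$. Then $\mu$ is a classical moment map (in the sense defined in the context, where the bracket on $X$ attached to the Lagrangian complement $\mathfrak h$ determined by the quantization is $\{-,-\}_X$).
   Context: $k$ is the ground commutative ring. Hopf-algebraic conventions. A skew-pairing $\gamma\colon P\otimes Q\to\mathcal A$ of Hopf algebras satisfies $\gamma(pp',q)=\gamma(p,q_{(1)})\gamma(p',q_{(2)})$, $\gamma(p,qq')=\gamma(p_{(1)},q')\gamma(p_{(2)},q)$, $\gamma(p,1)=\epsilon(p)$, $\gamma(1,q)=\epsilon(q)$. A coquasitriangular structure on a Hopf algebra $P$ is a skew-pairing $\mathbf r$ on $P\otimes P$ with $\mathbf r(a_{(1)},b_{(1)})a_{(2)}b_{(2)}=\mathbf r(a_{(2)},b_{(2)})b_{(1)}a_{(1)}$. Given a Hopf map $f\colon P\to H$, a $P$-coquasitriangular structure on $H$ is a skew-pairing $\mathbf r_H$ on $P\otimes H$ with $\mathbf r_H(d_1,f(d_2))=\mathbf r(d_1,d_2)$ and $\mathbf r_H(d_{(1)},h_{(1)})f(d_{(2)})h_{(2)}=\mathbf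 r_H(d_{(2)},h_{(2)})h_{(1)}f(d_{(1)})$. Quantization of the groups. $D$ is an affine algebraic group with Lie algebra $\mathfrak d$ and $G\subset D$ a closed subgroup with Lie algebra $\mathfrak g$. $\mathcal O_\hbar(D)$ is a coquasitriangular Hopf algebra flat over $\mathcal A$ with an isomorphism $\mathcal O_\hbar(D)/\hbar\cong\mathcal O(D)$ of coquasitriangular Hopf algebras ($\mathcal O(D)$ having the trivial structure $\epsilon\otimes\epsilon$); write its structure as $\mathbf r=\epsilon\otimes\epsilon+\hbar r$. $\mathcal O_\hbar(G)$ is an $\mathcal O_\hbar(D)$-coquasitriangular Hopf algebra flat over $\mathcal A$ with an isomorphism $\mathcal O_\hbar(G)/\hbar\cong\mathcal O(G)$ of $\mathcal O(D)$-coquasitriangular Hopf algebras; write its structure as $\mathbf r_G=\epsilon\otimes\epsilon+\hbar r_G$. Then $r\in\mathfrak d\otimes\mathfrak d$, the symmetric part $c$ of $r$ is $\mathfrak d$-invariant, and $r_G=r\in\mathfrak d\otimes\mathfrak g$. The bracket $\{a,b\}_G=(ab-ba)/\hbar$ is a multiplicative biderivation on $\mathcal O(G)$. Assume $c\in\mathrm{Sym}^2(\mathfrak d)^D$ is nondegenerate and $\mathfrak g\subset\mathfrak d$ is Lagrangian with respect to $c$, so that $(D,G)$ is a group pair. The map $r_2\colon\mathfrak g^*\to\mathfrak d$ given by pairing with the second component of $r$ is injective and its image $\mathfrak h$ is a Lagrangian complement to $\mathfrak g$; the map $r_1\colon\mathfrak d^*\to\mathfrak g$ given by pairing with the first component of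 $r$ is the map $p_{\mathfrak h}$ defined below. Quantization of $X$. $X$ is a $G$-variety and $A_\hbar$ is an $\mathcal O_\hbar(G)$-comodule algebra flat over $\mathcal A$ with an isomorphism $A_\hbar/\hbar\cong\mathcal O(X)$ of algebras and $G$-representations. Then $\{a,b\}_X=(ab-ba)/\hbar$ is a biderivation on $\mathcal O(X)$ and the coaction $\mathcal O(X)\to\mathcal O(X)\otimes\mathcal O(G)$ is compatible with the brackets. Quantum moment maps. $\mathrm{Rep}_\hbar(D)$, $\mathrm{Rep}_\hbar(G)$ are the categories of right $\mathcal O_\hbar(D)$-, $\mathcal O_\hbar(G)$-comodules in $\mathcal A$-modules; $T\colon\mathrm{Rep}_\hbar(D)\to\mathrm{Rep}_\hbar(G)$ is the monoidal forgetful functor along $\mathcal O_\hbar(D)\to\mathcal O_\hbar(G)$, $T^R$ its lax monoidal right adjoint, and $\mathcal F=TT^R(1)$, an algebra in $\mathrm{Rep}_\hbar(G)$ which at $\hbar=0$ is $\mathcal O(D/G)$. A quantum moment map is an algebra map $\mu_\hbar\colon\mathcal F\to A_\hbar$ in $\mathrm{Rep}_\hbar(G)$ with $m(\mu_\hbar\otimes\mathrm{id})=m(\mathrm{id}\otimes\mu_\hbar)\tau$, where $m$ is the multiplication of $A_\hbar$ and $\tau\colon\mathcal F\otimes A_\hbar\to A_\hbar\otimes\mathcal F$ is $h\otimes b\mapsto\mathbf r_G(h_{(1)},b_{(1)})\,b_{(0)}\otimes h_{(0)}$ (using the $\mathcal O_\hbar(D)$-coaction on $T^R(1)$ and the $\mathcal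 O_\hbar(G)$-coaction on $A_\hbar$). Classical moment maps. A group pair $(D,G)$ consists of algebraic groups, $G\subset D$ closed, with a nondegenerate $c\in\mathrm{Sym}^2(\mathfrak d)^D$ such that $\mathfrak g\subset\mathfrak d$ is Lagrangian. For a Lagrangian complement $\mathfrak h'\subset\mathfrak d$ to $\mathfrak g$ (not necessarily a subalgebra), $p_{\mathfrak h'}\colon\mathfrak d^*\cong\mathfrak d\to\mathfrak g$ is the projection determined by the complement. A quasi-Poisson structure on $G$ is a multiplicative bivector $\pi$ and $\phi\in\wedge^3\mathfrak g$ with $\tfrac12[\pi,\pi]=\phi^L-\phi^R$ and $[\pi,\phi^R]=0$; a quasi-Poisson $(G,\pi,\phi)$-variety is a $G$-variety with a bivector $\pi_X$ such that the action map is compatible with the bivectors and $\tfrac12[\pi_X,\pi_X]=a(\phi)$. Each Lagrangian complement $\mathfrak h'$ determines a quasi-Poisson structure $\pi_G^{\mathfrak h'}$ on $G$ (the one attached by Alekseev and Kosmann-Schwarzbach to $(D,G,\mathfrak h')$). For a group pair, a quasi-Poisson $G$-space is a $G$-variety $X$ with bivectors $\pi_X^{\mathfrak h'}$ for all Lagrangian complements $\mathfrak h'$, such that $(X,\pi_X^{\mathfrak h'})$ is a quasi-Poisson $(G,\pi_G^{\mathfrak h'})$-variety and $\pi_X^{\mathfrak h_2}=\pi_X^{\mathfrak h_1}-a(t)$ when $\mathfrak h_1,\mathfrak h_2$ differ by the twist $t\in\wedge^2\mathfrak g$ (i.e. $p_{\mathfrak h_2}-p_{\mathfrak h_1}$ is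 $\mathfrak d^*\to\mathfrak g^*\xrightarrow{-t}\mathfrak g$); $\{-,-\}_{\mathfrak h'}$ denotes the bracket of $\pi_X^{\mathfrak h'}$. A $G$-equivariant map $\mu\colon X\to D/G$ is a classical moment map if for some Lagrangian complement $\mathfrak h'\subset\mathfrak d$ $$\{\mu^*f_1,f_2\}_{\mathfrak h'}=\sum_i\mu^*(\tilde a(e_i).f_1)\cdot a(p_{\mathfrak h'}(e^i)).f_2$$ for every $f_1\in\mathcal O_{D/G}$ and $f_2\in\mathcal O_X$. Here $\{e_i\}$ is a basis of $\mathfrak d$, $\{e^i\}$ the dual basis of $\mathfrak d^*$, $\tilde a$ is the infinitesimal action of $\mathfrak d$ on $D/G$ (from left translation), and $a$ is the infinitesimal action of $\mathfrak g$ on $X$. *)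

theory Defs
  imports Complex_Main "HOL-Library.Multiset" "HOL-Library.Function_Algebras"
begin

section \<open>The base ring of first-order deformations\<close>

text \<open>\<open>\<A> = k[\<hbar>]/\<hbar>\<^sup>2\<close>; the element \<open>a + \<hbar> b\<close> is \<open>Dual a b\<close>.\<close>

datatype 'k dual_num = Dual (body: 'k) (infpart: 'k)

instantiation dual_num :: (comm_ring_1) comm_ring_1
begin

definition "0 = Dual 0 0"
definition "1 = Dual 1 0"
definition "x + y = Dual (body x + body y) (infpart x + infpart y)"
definition "x - y = Dual (body x - body y) (infpart x - infpart y)"
definition "- x = Dual (- body x) (- infpart x)"
definition "x * y = Dual (body x * body y) (body x * infpart y + infpart x * body y)"

instance
  by standard
    (auto simp: zero_dual_num_def one_dual_num_def plus_dual_num_def minus_dual_num_def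
      uminus_dual_num_def times_dual_num_def algebra_simps)

end

definition hbar :: "'k::comm_ring_1 dual_num" where
  "hbar = Dual 0 1"


section \<open>Tensor products\<close>

text \<open>
  An element of \<open>M \<otimes> N\<close> is represented by a formal sum of pure tensors, i.e. by a multiset of
  pairs, and \<open>tensor_eq\<close> is equality in \<open>M \<otimes> N\<close>: the tensor product is the quotient of the free
  commutative monoid on \<open>M \<times> N\<close> by the congruence that makes pure tensors bilinear (that
  quotient has negatives because \<open>(-1) m \<otimes> n\<close> is one). Here \<open>M\<close>, \<open>N\<close> are submodules of
  the ambient modules given by the scalings \<open>s\<close>, \<open>t\<close>. A map into a tensor product is represented
  by a choice of formal sums, and all conditions on it are imposed up to \<open>tensor_eq\<close>. In this
  notation Sweedler sums are sums over multisets.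
\<close>

inductive mset_cong :: "('t multiset \<Rightarrow> 't multiset \<Rightarrow> bool) \<Rightarrow> 't multiset \<Rightarrow> 't multiset \<Rightarrow> bool"
  for R where
  base: "R x y \<Longrightarrow> mset_cong R x y"
| refl: "mset_cong R x x"
| sym: "mset_cong R x y \<Longrightarrow> mset_cong R y x"
| trans: "mset_cong R x y \<Longrightarrow> mset_cong R y z \<Longrightarrow> mset_cong R x z"
| add: "mset_cong R x y \<Longrightarrow> mset_cong R u v \<Longrightarrow> mset_cong R (x + u) (y + v)"

inductive bilinear_rel ::
  "'m set \<Rightarrow> ('r::comm_ring_1 \<Rightarrow> 'm::ab_group_add \<Rightarrow> 'm) \<Rightarrow>
   'n set \<Rightarrow> ('r \<Rightarrow> 'n::ab_group_add \<Rightarrow> 'n) \<Rightarrow>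
   ('m \<times> 'n) multiset \<Rightarrow> ('m \<times> 'n) multiset \<Rightarrow> bool"
  for M s N t where
  zero: "n \<in> N \<Longrightarrow> bilinear_rel M s N t {#(0, n)#} {#}"
| add_left: "m \<in> M \<Longrightarrow> m' \<in> M \<Longrightarrow> n \<in> N \<Longrightarrow>
    bilinear_rel M s N t {#(m + m', n)#} {#(m, n), (m', n)#}"
| add_right: "m \<in> M \<Longrightarrow> n \<in> N \<Longrightarrow> n' \<in> N \<Longrightarrow>
    bilinear_rel M s N t {#(m, n + n')#} {#(m, n), (m, n')#}"
| balanced: "m \<in> M \<Longrightarrow> n \<in> N \<Longrightarrow> bilinear_rel M s N t {#(s r m, n)#} {#(m, t r n)#}"

definition tensor_eq ::
  "'m set \<Rightarrow> ('r::comm_ring_1 \<Rightarrow> 'm::ab_group_add \<Rightarrow> 'm) \<Rightarrow>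
   'n set \<Rightarrow> ('r \<Rightarrow> 'n::ab_group_add \<Rightarrow> 'n) \<Rightarrow>
   ('m \<times> 'n) multiset \<Rightarrow> ('m \<times> 'n) multiset \<Rightarrow> bool" where
  "tensor_eq M s N t = mset_cong (bilinear_rel M s N t)"

inductive trilinear_rel ::
  "'m set \<Rightarrow> ('r::comm_ring_1 \<Rightarrow> 'm::ab_group_add \<Rightarrow> 'm) \<Rightarrow>
   'n set \<Rightarrow> ('r \<Rightarrow> 'n::ab_group_add \<Rightarrow> 'n) \<Rightarrow>
   'l set \<Rightarrow> ('r \<Rightarrow> 'l::ab_group_add \<Rightarrow> 'l) \<Rightarrow>
   ('m \<times> 'n \<times> 'l) multiset \<Rightarrow> ('m \<times> 'n \<times> 'l) multiset \<Rightarrow> bool"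
  for M s N t L w where
  zero: "n \<in> N \<Longrightarrow> l \<in> L \<Longrightarrow> trilinear_rel M s N t L w {#(0, n, l)#} {#}"
| add1: "m \<in> M \<Longrightarrow> m' \<in> M \<Longrightarrow> n \<in> N \<Longrightarrow> l \<in> L \<Longrightarrow>
    trilinear_rel M s N t L w {#(m + m', n, l)#} {#(m, n, l), (m', n, l)#}"
| add2: "m \<in> M \<Longrightarrow> n \<in> N \<Longrightarrow> n' \<in> N \<Longrightarrow> l \<in> L \<Longrightarrow>
    trilinear_rel M s N t L w {#(m, n + n', l)#} {#(m, n, l), (m, n', l)#}"
| add3: "m \<in> M \<Longrightarrow> n \<in> N \<Longrightarrow> l \<in> L \<Longrightarrow> l' \<in> L \<Longrightarrow>
    trilinear_rel M s N t L w {#(m, n, l + l')#} {#(m, n, l), (m, n, l')#}"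
| balanced12: "m \<in> M \<Longrightarrow> n \<in> N \<Longrightarrow> l \<in> L \<Longrightarrow>
    trilinear_rel M s N t L w {#(s r m, n, l)#} {#(m, t r n, l)#}"
| balanced23: "m \<in> M \<Longrightarrow> n \<in> N \<Longrightarrow> l \<in> L \<Longrightarrow>
    trilinear_rel M s N t L w {#(m, t r n, l)#} {#(m, n, w r l)#}"

definition tensor3_eq ::
  "'m set \<Rightarrow> ('r::comm_ring_1 \<Rightarrow> 'm::ab_group_add \<Rightarrow> 'm) \<Rightarrow>
   'n set \<Rightarrow> ('r \<Rightarrow> 'n::ab_group_add \<Rightarrow> 'n) \<Rightarrow>
   'l set \<Rightarrow> ('r \<Rightarrow> 'l::ab_group_add \<Rightarrow> 'l) \<Rightarrow>
   ('m \<times> 'n \<times> 'l) multiset \<Rightarrow> ('m \<times> 'n \<times> 'l) multiset \<Rightarrow> bool" where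
  "tensor3_eq M s N t L w = mset_cong (trilinear_rel M s N t L w)"

text \<open>Flatness: \<open>I \<otimes> M \<rightarrow> M\<close> is injective for every ideal \<open>I\<close> of the base ring.\<close>

definition flat :: "('r::comm_ring_1 \<Rightarrow> 'm::ab_group_add \<Rightarrow> 'm) \<Rightarrow> bool" where
  "flat s \<longleftrightarrow> (\<forall>I. module.subspace (*) I \<longrightarrow>
     (\<forall>u. set_mset u \<subseteq> I \<times> UNIV \<and> (\<Sum>(a, m)\<in>#u. s a m) = 0 \<longrightarrow>
        tensor_eq I (*) UNIV s u {#}))"


section \<open>Hopf algebras, comodule algebras\<close>

text \<open>
  Units are passed explicitly where the class \<^class>\<open>ring\<close> is used, so that the zero ring
  (functions on the empty variety) is not excluded.
\<close>

definition assoc_algebra :: "'a set \<Rightarrow> ('r::comm_ring_1 \<Rightarrow> 'a::ring \<Rightarrow> 'a) \<Rightarrow> 'a \<Rightarrow> bool" where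
  "assoc_algebra A s u \<longleftrightarrow>
     module s \<and> module.subspace s A \<and> u \<in> A \<and>
     (\<forall>x\<in>A. \<forall>y\<in>A. x * y \<in> A) \<and>
     (\<forall>x\<in>A. u * x = x \<and> x * u = x) \<and>
     (\<forall>r. \<forall>x\<in>A. \<forall>y\<in>A. s r x * y = s r (x * y) \<and> x * s r y = s r (x * y))"

record ('r, 'h) hopf =
  scl :: "'r \<Rightarrow> 'h \<Rightarrow> 'h"
  comul :: "'h \<Rightarrow> ('h \<times> 'h) multiset"
  counit :: "'h \<Rightarrow> 'r"
  antip :: "'h \<Rightarrow> 'h"

definition hopf_algebra :: "('r::comm_ring_1, 'h::ring_1) hopf \<Rightarrow> bool" where
  "hopf_algebra H \<longleftrightarrow>
     assoc_algebra UNIV (scl H) 1 \<and>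
     module_hom (scl H) (*) (counit H) \<and>
     module_hom (scl H) (scl H) (antip H) \<and>
     (\<forall>x y. tensor_eq UNIV (scl H) UNIV (scl H) (comul H (x + y)) (comul H x + comul H y)) \<and>
     (\<forall>r x. tensor_eq UNIV (scl H) UNIV (scl H) (comul H (scl H r x))
        (\<Sum>(a, b)\<in>#comul H x. {#(scl H r a, b)#})) \<and>
     (\<forall>x. tensor3_eq UNIV (scl H) UNIV (scl H) UNIV (scl H)
        (\<Sum>(a, b)\<in>#comul H x. \<Sum>(a1, a2)\<in>#comul H a. {#(a1, a2, b)#})
        (\<Sum>(a, b)\<in>#comul H x. \<Sum>(b1, b2)\<in>#comul H b. {#(a, b1, b2)#})) \<and>
     (\<forall>x. (\<Sum>(a, b)\<in>#comul H x. scl H (counit H a) b) = x) \<and>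
     (\<forall>x. (\<Sum>(a, b)\<in>#comul H x. scl H (counit H b) a) = x) \<and>
     (\<forall>x y. tensor_eq UNIV (scl H) UNIV (scl H) (comul H (x * y))
        (\<Sum>(a, b)\<in>#comul H x. \<Sum>(c, d)\<in>#comul H y. {#(a * c, b * d)#})) \<and>
     tensor_eq UNIV (scl H) UNIV (scl H) (comul H 1) {#(1, 1)#} \<and>
     (\<forall>x y. counit H (x * y) = counit H x * counit H y) \<and> counit H 1 = 1 \<and>
     (\<forall>x. (\<Sum>(a, b)\<in>#comul H x. antip H a * b) = scl H (counit H x) 1) \<and>
     (\<forall>x. (\<Sum>(a, b)\<in>#comul H x. a * antip H b) = scl H (counit H x) 1)"

text \<open>
  Hopf maps along a map of base rings \<open>\<sigma>\<close>: with \<open>\<sigma> = id\<close> these are the Hopf algebra maps, with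
  \<open>\<sigma> = body\<close> they are the Hopf algebra maps \<open>H/\<hbar> \<rightarrow> K\<close>.
\<close>

definition hopf_map ::
  "('r::comm_ring_1 \<Rightarrow> 'q::comm_ring_1) \<Rightarrow> ('r, 'h::ring_1) hopf \<Rightarrow> ('q, 'l::ring_1) hopf \<Rightarrow>
   ('h \<Rightarrow> 'l) \<Rightarrow> bool" where
  "hopf_map \<sigma> H K f \<longleftrightarrow>
     (\<forall>x y. f (x + y) = f x + f y) \<and> (\<forall>r x. f (scl H r x) = scl K (\<sigma> r) (f x)) \<and>
     (\<forall>x y. f (x * y) = f x * f y) \<and> f 1 = 1 \<and>
     (\<forall>x. tensor_eq UNIV (scl K) UNIV (scl K) (comul K (f x))
        (\<Sum>(a, b)\<in>#comul H x. {#(f a, f b)#})) \<and>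
     (\<forall>x. counit K (f x) = \<sigma> (counit H x)) \<and>
     (\<forall>x. f (antip H x) = antip K (f x))"

text \<open>Right \<open>H\<close>-comodules: \<open>\<delta> : M \<rightarrow> M \<otimes> H\<close>.\<close>

definition right_comodule ::
  "('r::comm_ring_1, 'h::ring_1) hopf \<Rightarrow> 'm set \<Rightarrow> ('r \<Rightarrow> 'm::ab_group_add \<Rightarrow> 'm) \<Rightarrow>
   ('m \<Rightarrow> ('m \<times> 'h) multiset) \<Rightarrow> bool" where
  "right_comodule H M s \<delta> \<longleftrightarrow>
     module s \<and> module.subspace s M \<and>
     (\<forall>x\<in>M. set_mset (\<delta> x) \<subseteq> M \<times> UNIV) \<and>
     (\<forall>x\<in>M. \<forall>y\<in>M. tensor_eq M s UNIV (scl H) (\<delta> (x + y)) (\<delta> x + \<delta> y)) \<and>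
     (\<forall>r. \<forall>x\<in>M. tensor_eq M s UNIV (scl H) (\<delta> (s r x)) (\<Sum>(a, h)\<in>#\<delta> x. {#(s r a, h)#})) \<and>
     (\<forall>x\<in>M. tensor3_eq M s UNIV (scl H) UNIV (scl H)
        (\<Sum>(a, h)\<in>#\<delta> x. \<Sum>(a0, a1)\<in>#\<delta> a. {#(a0, a1, h)#})
        (\<Sum>(a, h)\<in>#\<delta> x. \<Sum>(h1, h2)\<in>#comul H h. {#(a, h1, h2)#})) \<and>
     (\<forall>x\<in>M. (\<Sum>(a, h)\<in>#\<delta> x. s (counit H h) a) = x)"

record ('r, 'h, 'a) comod_alg =
  carr :: "'a set"
  cscl :: "'r \<Rightarrow> 'a \<Rightarrow> 'a"
  cunit :: "'a"
  coact :: "'a \<Rightarrow> ('a \<times> 'h) multiset"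

definition comodule_algebra ::
  "('r::comm_ring_1, 'h::ring_1) hopf \<Rightarrow> ('r, 'h, 'a::ring) comod_alg \<Rightarrow> bool" where
  "comodule_algebra H A \<longleftrightarrow>
     assoc_algebra (carr A) (cscl A) (cunit A) \<and>
     right_comodule H (carr A) (cscl A) (coact A) \<and>
     (\<forall>x\<in>carr A. \<forall>y\<in>carr A. tensor_eq (carr A) (cscl A) UNIV (scl H) (coact A (x * y))
        (\<Sum>(a, g)\<in>#coact A x. \<Sum>(b, h)\<in>#coact A y. {#(a * b, g * h)#})) \<and>
     tensor_eq (carr A) (cscl A) UNIV (scl H) (coact A (cunit A)) {#(cunit A, 1)#}"

text \<open>
  Maps \<open>\<psi> : A \<rightarrow> B\<close> of comodule algebras along \<open>\<sigma>\<close> on base rings and along the Hopf map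
  \<open>f : H \<rightarrow> K\<close>; with \<open>\<sigma> = id\<close> these are the algebra maps in \<open>K\<close>-comodules from the corestriction
  of \<open>A\<close> along \<open>f\<close> to \<open>B\<close>.
\<close>

definition comod_alg_map ::
  "('r::comm_ring_1 \<Rightarrow> 'q::comm_ring_1) \<Rightarrow> ('q, 'l::ring_1) hopf \<Rightarrow> ('h::ring_1 \<Rightarrow> 'l) \<Rightarrow>
   ('r, 'h, 'a::ring) comod_alg \<Rightarrow> ('q, 'l, 'b::ring) comod_alg \<Rightarrow> ('a \<Rightarrow> 'b) \<Rightarrow> bool" where
  "comod_alg_map \<sigma> K f A B \<psi> \<longleftrightarrow>
     (\<forall>x\<in>carr A. \<psi> x \<in> carr B) \<and>
     (\<forall>x\<in>carr A. \<forall>y\<in>carr A. \<psi> (x + y) = \<psi> x + \<psi> y) \<and>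
     (\<forall>r. \<forall>x\<in>carr A. \<psi> (cscl A r x) = cscl B (\<sigma> r) (\<psi> x)) \<and>
     (\<forall>x\<in>carr A. \<forall>y\<in>carr A. \<psi> (x * y) = \<psi> x * \<psi> y) \<and>
     \<psi> (cunit A) = cunit B \<and>
     (\<forall>x\<in>carr A. tensor_eq (carr B) (cscl B) UNIV (scl K) (coact B (\<psi> x))
        (\<Sum>(a, h)\<in>#coact A x. {#(\<psi> a, f h)#}))"

text \<open>\<open>\<rho>\<close> induces an isomorphism \<open>M/\<hbar>M \<cong> N\<close> (of \<open>k\<close>-modules).\<close>

definition reduces_to ::
  "'m set \<Rightarrow> ('k::comm_ring_1 dual_num \<Rightarrow> 'm::ab_group_add \<Rightarrow> 'm) \<Rightarrow>
   'n set \<Rightarrow> ('k \<Rightarrow> 'n::ab_group_add \<Rightarrow> 'n) \<Rightarrow> ('m \<Rightarrow> 'n) \<Rightarrow> bool" where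
  "reduces_to M s N t \<rho> \<longleftrightarrow>
     (\<forall>x\<in>M. \<forall>y\<in>M. \<rho> (x + y) = \<rho> x + \<rho> y) \<and>
     (\<forall>r. \<forall>x\<in>M. \<rho> (s r x) = t (body r) (\<rho> x)) \<and>
     \<rho> ` M = N \<and> {x \<in> M. \<rho> x = 0} = s hbar ` M"


section \<open>Coquasitriangular structures\<close>

definition skew_pairing ::
  "('r::comm_ring_1, 'p::ring_1) hopf \<Rightarrow> ('r, 'q::ring_1) hopf \<Rightarrow> ('p \<Rightarrow> 'q \<Rightarrow> 'r) \<Rightarrow> bool" where
  "skew_pairing P Q \<gamma> \<longleftrightarrow>
     (\<forall>p. module_hom (scl Q) (*) (\<gamma> p)) \<and> (\<forall>q. module_hom (scl P) (*) (\<lambda>p. \<gamma> p q)) \<and>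
     (\<forall>p p' q. \<gamma> (p * p') q = (\<Sum>(q1, q2)\<in>#comul Q q. \<gamma> p q1 * \<gamma> p' q2)) \<and>
     (\<forall>p q q'. \<gamma> p (q * q') = (\<Sum>(p1, p2)\<in>#comul P p. \<gamma> p1 q' * \<gamma> p2 q)) \<and>
     (\<forall>p. \<gamma> p 1 = counit P p) \<and> (\<forall>q. \<gamma> 1 q = counit Q q)"

definition coquasitriangular ::
  "('r::comm_ring_1, 'p::ring_1) hopf \<Rightarrow> ('p \<Rightarrow> 'p \<Rightarrow> 'r) \<Rightarrow> bool" where
  "coquasitriangular P R \<longleftrightarrow>
     skew_pairing P P R \<and>
     (\<forall>a b. (\<Sum>(a1, a2)\<in>#comul P a. \<Sum>(b1, b2)\<in>#comul P b. scl P (R a1 b1) (a2 * b2)) =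
            (\<Sum>(a1, a2)\<in>#comul P a. \<Sum>(b1, b2)\<in>#comul P b. scl P (R a2 b2) (b1 * a1)))"

definition rel_coquasitriangular ::
  "('r::comm_ring_1, 'p::ring_1) hopf \<Rightarrow> ('p \<Rightarrow> 'p \<Rightarrow> 'r) \<Rightarrow> ('r, 'h::ring_1) hopf \<Rightarrow>
   ('p \<Rightarrow> 'h) \<Rightarrow> ('p \<Rightarrow> 'h \<Rightarrow> 'r) \<Rightarrow> bool" where
  "rel_coquasitriangular P R H f RH \<longleftrightarrow>
     skew_pairing P H RH \<and>
     (\<forall>d1 d2. RH d1 (f d2) = R d1 d2) \<and>
     (\<forall>d h. (\<Sum>(d1, d2)\<in>#comul P d. \<Sum>(h1, h2)\<in>#comul H h. scl H (RH d1 h1) (f d2 * h2)) =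
            (\<Sum>(d1, d2)\<in>#comul P d. \<Sum>(h1, h2)\<in>#comul H h. scl H (RH d2 h2) (h1 * f d1)))"


section \<open>Groups and first-order quantizations\<close>

definition affine_algebraic_group :: "('k::comm_ring_1, 'd::comm_ring_1) hopf \<Rightarrow> bool" where
  "affine_algebraic_group H \<longleftrightarrow>
     hopf_algebra H \<and>
     (\<exists>S. finite S \<and> (\<forall>B. S \<subseteq> B \<and> assoc_algebra B (scl H) 1 \<longrightarrow> B = UNIV))"

definition closed_subgroup ::
  "('k::comm_ring_1, 'd::comm_ring_1) hopf \<Rightarrow> ('k, 'g::comm_ring_1) hopf \<Rightarrow> ('d \<Rightarrow> 'g) \<Rightarrow> bool" where
  "closed_subgroup D G p \<longleftrightarrow>
     affine_algebraic_group D \<and> affine_algebraic_group G \<and> hopf_map id D G p \<and> surj p"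

definition quantizes_hopf ::
  "('k::comm_ring_1 dual_num, 'p::ring_1) hopf \<Rightarrow> ('k, 'd::comm_ring_1) hopf \<Rightarrow> ('p \<Rightarrow> 'd) \<Rightarrow> bool" where
  "quantizes_hopf H O0 \<rho> \<longleftrightarrow>
     hopf_algebra H \<and> flat (scl H) \<and> hopf_map body H O0 \<rho> \<and>
     reduces_to UNIV (scl H) UNIV (scl O0) \<rho>"

definition quantizes_group ::
  "('k::comm_ring_1 dual_num, 'p::ring_1) hopf \<Rightarrow> ('p \<Rightarrow> 'p \<Rightarrow> 'k dual_num) \<Rightarrow>
   ('k, 'd::comm_ring_1) hopf \<Rightarrow> ('p \<Rightarrow> 'd) \<Rightarrow> bool" where
  "quantizes_group HD R D \<rho>D \<longleftrightarrow>
     quantizes_hopf HD D \<rho>D \<and> coquasitriangular HD R \<and>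
     (\<forall>a b. body (R a b) = counit D (\<rho>D a) * counit D (\<rho>D b))"

definition quantizes_subgroup ::
  "('k::comm_ring_1 dual_num, 'p::ring_1) hopf \<Rightarrow> ('p \<Rightarrow> 'p \<Rightarrow> 'k dual_num) \<Rightarrow>
   ('k dual_num, 'h::ring_1) hopf \<Rightarrow> ('p \<Rightarrow> 'h) \<Rightarrow> ('p \<Rightarrow> 'h \<Rightarrow> 'k dual_num) \<Rightarrow>
   ('k, 'd::comm_ring_1) hopf \<Rightarrow> ('p \<Rightarrow> 'd) \<Rightarrow>
   ('k, 'g::comm_ring_1) hopf \<Rightarrow> ('h \<Rightarrow> 'g) \<Rightarrow> ('d \<Rightarrow> 'g) \<Rightarrow> bool" where
  "quantizes_subgroup HD R HG ph RG D \<rho>D G \<rho>G p \<longleftrightarrow>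
     quantizes_hopf HG G \<rho>G \<and> hopf_map id HD HG ph \<and>
     rel_coquasitriangular HD R HG ph RG \<and>
     (\<forall>a. \<rho>G (ph a) = p (\<rho>D a)) \<and>
     (\<forall>a b. body (RG a b) = counit D (\<rho>D a) * counit G (\<rho>G b))"

text \<open>
  \<open>A\<close> is an \<open>O\<^sub>\<hbar>(G)\<close>-comodule algebra and \<open>X\<close> encodes \<open>O(X)\<close> with its \<open>O(G)\<close>-coaction; the underlying
  modules are the whole types.
\<close>

definition quantizes_variety ::
  "('k::comm_ring_1 dual_num, 'h::ring_1) hopf \<Rightarrow> ('k dual_num, 'h, 'a::ring) comod_alg \<Rightarrow>
   ('k, 'g::comm_ring_1) hopf \<Rightarrow> ('h \<Rightarrow> 'g) \<Rightarrow> ('k, 'g, 'x::comm_ring) comod_alg \<Rightarrow>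
   ('a \<Rightarrow> 'x) \<Rightarrow> bool" where
  "quantizes_variety HG A G \<rho>G X \<rho>X \<longleftrightarrow>
     carr A = UNIV \<and> comodule_algebra HG A \<and> flat (cscl A) \<and>
     carr X = UNIV \<and> comodule_algebra G X \<and>
     comod_alg_map body G \<rho>G A X \<rho>X \<and>
     reduces_to UNIV (cscl A) UNIV (cscl X) \<rho>X"

text \<open>The \<open>r\<close> in \<open>R = \<epsilon> \<otimes> \<epsilon> + \<hbar> r\<close>, as a bilinear form on the classical Hopf algebras.\<close>

definition first_order ::
  "('k::comm_ring_1 dual_num, 'p::ring_1) hopf \<Rightarrow> ('p \<Rightarrow> 'd) \<Rightarrow>
   ('k dual_num, 'q::ring_1) hopf \<Rightarrow> ('q \<Rightarrow> 'g) \<Rightarrow> ('p \<Rightarrow> 'q \<Rightarrow> 'k dual_num) \<Rightarrow> 'd \<Rightarrow> 'g \<Rightarrow> 'k" where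
  "first_order P \<rho> Q \<rho>' R x y =
     (THE t. \<exists>a b. \<rho> a = x \<and> \<rho>' b = y \<and> R a b = counit P a * counit Q b + hbar * Dual t 0)"

text \<open>The bracket \<open>(ab - ba)/\<hbar>\<close> on \<open>O(X)\<close>.\<close>

definition semiclassical_bracket ::
  "('k::comm_ring_1 dual_num, 'h, 'a::ring) comod_alg \<Rightarrow> ('a \<Rightarrow> 'x) \<Rightarrow> 'x \<Rightarrow> 'x \<Rightarrow> 'x" where
  "semiclassical_bracket A \<rho>X f g =
     (THE v. \<exists>a b c. \<rho>X a = f \<and> \<rho>X b = g \<and> a * b - b * a = cscl A hbar c \<and> v = \<rho>X c)"


section \<open>Lie algebras and group pairs\<close>

definition fscale :: "'k::comm_ring_1 \<Rightarrow> ('a \<Rightarrow> 'k) \<Rightarrow> 'a \<Rightarrow> 'k" where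
  "fscale c x = (\<lambda>a. c * x a)"

text \<open>The Lie algebra: \<open>\<epsilon>\<close>-derivations \<open>O(G) \<rightarrow> k\<close>.\<close>

definition lie :: "('k::comm_ring_1, 'd::comm_ring_1) hopf \<Rightarrow> ('d \<Rightarrow> 'k) set" where
  "lie H = {x. module_hom (scl H) (*) x \<and>
               (\<forall>a b. x (a * b) = counit H a * x b + x a * counit H b)}"

text \<open>Elements of the linear dual of \<open>L\<close> are extended by zero outside \<open>L\<close>.\<close>

definition dual_space :: "('a \<Rightarrow> 'k::comm_ring_1) set \<Rightarrow> (('a \<Rightarrow> 'k) \<Rightarrow> 'k) set" where
  "dual_space L = {\<alpha>. (\<forall>x\<in>L. \<forall>y\<in>L. \<alpha> (x + y) = \<alpha> x + \<alpha> y) \<and>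
                      (\<forall>c. \<forall>x\<in>L. \<alpha> (fscale c x) = c * \<alpha> x) \<and> (\<forall>x. x \<notin> L \<longrightarrow> \<alpha> x = 0)}"

text \<open>
  An element \<open>\<Sum> x\<^sub>i \<otimes> y\<^sub>i\<close> of \<open>L \<otimes> M\<close>, for Lie algebras \<open>L\<close>, \<open>M\<close>, is identified with the bilinear
  form \<open>(a, b) \<mapsto> \<Sum> x\<^sub>i(a) y\<^sub>i(b)\<close> on functions (an injective assignment when \<open>L\<close> is free of finite
  rank). \<open>contract1\<close> and \<open>contract2\<close> pair its first, respectively second, component with a covector.
\<close>

definition form_of :: "(('a \<Rightarrow> 'k::comm_ring_1) \<times> ('b \<Rightarrow> 'k)) multiset \<Rightarrow> 'a \<Rightarrow> 'b \<Rightarrow> 'k" where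
  "form_of u a b = (\<Sum>(x, y)\<in>#u. x a * y b)"

definition tensor_forms ::
  "('a \<Rightarrow> 'k::comm_ring_1) set \<Rightarrow> ('b \<Rightarrow> 'k) set \<Rightarrow> ('a \<Rightarrow> 'b \<Rightarrow> 'k) set" where
  "tensor_forms L M = {form_of u | u. set_mset u \<subseteq> L \<times> M}"

definition tensor_rep ::
  "('a \<Rightarrow> 'k::comm_ring_1) set \<Rightarrow> ('b \<Rightarrow> 'k) set \<Rightarrow> ('a \<Rightarrow> 'b \<Rightarrow> 'k) \<Rightarrow>
   (('a \<Rightarrow> 'k) \<times> ('b \<Rightarrow> 'k)) multiset" where
  "tensor_rep L M r = (SOME u. set_mset u \<subseteq> L \<times> M \<and> form_of u = r)"

definition contract1 ::
  "('a \<Rightarrow> 'k::comm_ring_1) set \<Rightarrow> ('b \<Rightarrow> 'k) set \<Rightarrow> ('a \<Rightarrow> 'b \<Rightarrow> 'k) \<Rightarrow>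
   (('a \<Rightarrow> 'k) \<Rightarrow> 'k) \<Rightarrow> 'b \<Rightarrow> 'k" where
  "contract1 L M r \<alpha> = (\<Sum>(x, y)\<in>#tensor_rep L M r. fscale (\<alpha> x) y)"

definition contract2 ::
  "('a \<Rightarrow> 'k::comm_ring_1) set \<Rightarrow> ('b \<Rightarrow> 'k) set \<Rightarrow> ('a \<Rightarrow> 'b \<Rightarrow> 'k) \<Rightarrow>
   (('b \<Rightarrow> 'k) \<Rightarrow> 'k) \<Rightarrow> 'a \<Rightarrow> 'k" where
  "contract2 L M r \<xi> = (\<Sum>(x, y)\<in>#tensor_rep L M r. fscale (\<xi> y) x)"

text \<open>
  The symmetric part of \<open>r\<close> is normalized as \<open>r + r\<^sub>2\<^sub>1\<close>. With this normalization (and not with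
  half of it) pairing \<open>r\<close> with covectors in its first component is the projection \<open>\<dd>\<^sup>* \<cong> \<dd> \<rightarrow> \<gg>\<close>
  along the image of \<open>\<gg>\<^sup>* \<rightarrow> \<dd>\<close>.
\<close>

definition symmetric_part :: "('a \<Rightarrow> 'a \<Rightarrow> 'k::comm_ring_1) \<Rightarrow> 'a \<Rightarrow> 'a \<Rightarrow> 'k" where
  "symmetric_part r a b = r a b + r b a"

text \<open>The isomorphism \<open>\<dd>\<^sup>* \<rightarrow> \<dd>\<close> given by \<open>c\<close>, and the bilinear form on \<open>\<dd>\<close> inverse to \<open>c\<close>.\<close>

definition sharp ::
  "('k::comm_ring_1, 'd::comm_ring_1) hopf \<Rightarrow> ('d \<Rightarrow> 'd \<Rightarrow> 'k) \<Rightarrow> (('d \<Rightarrow> 'k) \<Rightarrow> 'k) \<Rightarrow> 'd \<Rightarrow> 'k" where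
  "sharp D c = contract1 (lie D) (lie D) c"

definition nondegenerate ::
  "('k::comm_ring_1, 'd::comm_ring_1) hopf \<Rightarrow> ('d \<Rightarrow> 'd \<Rightarrow> 'k) \<Rightarrow> bool" where
  "nondegenerate D c \<longleftrightarrow> bij_betw (sharp D c) (dual_space (lie D)) (lie D)"

definition pairing ::
  "('k::comm_ring_1, 'd::comm_ring_1) hopf \<Rightarrow> ('d \<Rightarrow> 'd \<Rightarrow> 'k) \<Rightarrow> ('d \<Rightarrow> 'k) \<Rightarrow> ('d \<Rightarrow> 'k) \<Rightarrow> 'k" where
  "pairing D c x y = inv_into (dual_space (lie D)) (sharp D c) x y"

definition lagrangian ::
  "('k::comm_ring_1, 'd::comm_ring_1) hopf \<Rightarrow> ('d \<Rightarrow> 'd \<Rightarrow> 'k) \<Rightarrow> ('d \<Rightarrow> 'k) set \<Rightarrow> bool" where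
  "lagrangian D c L \<longleftrightarrow>
     module.subspace fscale L \<and> L \<subseteq> lie D \<and> {x \<in> lie D. \<forall>y\<in>L. pairing D c x y = 0} = L"

text \<open>The image of \<open>\<gg>\<close> in \<open>\<dd>\<close>, for \<open>G \<subseteq> D\<close> given by \<open>p : O(D) \<rightarrow> O(G)\<close>.\<close>

definition sub_lie :: "('k::comm_ring_1, 'g::comm_ring_1) hopf \<Rightarrow> ('d \<Rightarrow> 'g) \<Rightarrow> ('d \<Rightarrow> 'k) set" where
  "sub_lie G p = (\<lambda>y. y \<circ> p) ` lie G"

definition comul3 :: "('k, 'd) hopf \<Rightarrow> 'd \<Rightarrow> ('d \<times> 'd \<times> 'd) multiset" where
  "comul3 H x = (\<Sum>(a, b)\<in>#comul H x. \<Sum>(b1, b2)\<in>#comul H b. {#(a, b1, b2)#})"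

text \<open>Invariance of \<open>c \<in> \<dd> \<otimes> \<dd>\<close> under the adjoint action of the group \<open>D\<close>.\<close>

definition ad_invariant ::
  "('k::comm_ring_1, 'd::comm_ring_1) hopf \<Rightarrow> ('d \<Rightarrow> 'd \<Rightarrow> 'k) \<Rightarrow> bool" where
  "ad_invariant D c \<longleftrightarrow>
     (\<forall>a b. (\<Sum>(a1, a2, a3)\<in>#comul3 D a. \<Sum>(b1, b2, b3)\<in>#comul3 D b.
               scl D (c a2 b2) (a1 * antip D a3 * (b1 * antip D b3))) = scl D (c a b) 1)"

definition group_pair ::
  "('k::comm_ring_1, 'd::comm_ring_1) hopf \<Rightarrow> ('k, 'g::comm_ring_1) hopf \<Rightarrow> ('d \<Rightarrow> 'g) \<Rightarrow>
   ('d \<Rightarrow> 'd \<Rightarrow> 'k) \<Rightarrow> bool" where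
  "group_pair D G p c \<longleftrightarrow>
     closed_subgroup D G p \<and>
     c \<in> tensor_forms (lie D) (lie D) \<and> (\<forall>a b. c a b = c b a) \<and> ad_invariant D c \<and>
     nondegenerate D c \<and> lagrangian D c (sub_lie G p)"

definition lagrangian_complement ::
  "('k::comm_ring_1, 'd::comm_ring_1) hopf \<Rightarrow> ('k, 'g::comm_ring_1) hopf \<Rightarrow> ('d \<Rightarrow> 'g) \<Rightarrow>
   ('d \<Rightarrow> 'd \<Rightarrow> 'k) \<Rightarrow> ('d \<Rightarrow> 'k) set \<Rightarrow> bool" where
  "lagrangian_complement D G p c h \<longleftrightarrow>
     lagrangian D c h \<and> sub_lie G p \<inter> h = {0} \<and>
     (\<forall>z\<in>lie D. \<exists>x\<in>sub_lie G p. \<exists>y\<in>h. z = x + y)"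

text \<open>The projection \<open>p\<^sub>h : \<dd>\<^sup>* \<cong> \<dd> \<rightarrow> \<gg>\<close> along the complement \<open>h\<close>.\<close>

definition proj_along ::
  "('k::comm_ring_1, 'd::comm_ring_1) hopf \<Rightarrow> ('k, 'g::comm_ring_1) hopf \<Rightarrow> ('d \<Rightarrow> 'g) \<Rightarrow>
   ('d \<Rightarrow> 'd \<Rightarrow> 'k) \<Rightarrow> ('d \<Rightarrow> 'k) set \<Rightarrow> (('d \<Rightarrow> 'k) \<Rightarrow> 'k) \<Rightarrow> 'g \<Rightarrow> 'k" where
  "proj_along D G p c h \<alpha> = (THE y. y \<in> lie G \<and> sharp D c \<alpha> - (y \<circ> p) \<in> h)"

text \<open>The complement determined by the quantization: the image of \<open>r\<^sub>2 : \<gg>\<^sup>* \<rightarrow> \<dd>\<close>.\<close>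

definition quantum_complement ::
  "('k::comm_ring_1, 'd::comm_ring_1) hopf \<Rightarrow> ('k, 'g::comm_ring_1) hopf \<Rightarrow>
   ('d \<Rightarrow> 'g \<Rightarrow> 'k) \<Rightarrow> ('d \<Rightarrow> 'k) set" where
  "quantum_complement D G r = contract2 (lie D) (lie G) r ` dual_space (lie G)"


section \<open>Brackets and twists\<close>

text \<open>
  The infinitesimal action on a comodule, \<open>x.f = f\<^sub>0 x(f\<^sub>1)\<close>: the derivative of the representation
  defined by the coaction.
\<close>

definition inf_act :: "('k::comm_ring_1, 'h, 'a::ring) comod_alg \<Rightarrow> ('h \<Rightarrow> 'k) \<Rightarrow> 'a \<Rightarrow> 'a" where
  "inf_act X x f = (\<Sum>(f0, f1)\<in>#coact X f. cscl X (x f1) f0)"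

text \<open>
  A multiset \<open>t\<close> of pairs \<open>(x, y)\<close> in \<open>\<gg>\<close> stands for \<open>\<Sum> x \<and> y = \<Sum> (x \<otimes> y - y \<otimes> x)\<close> in the exterior
  square of \<open>\<gg>\<close>. The map \<open>t : \<gg>\<^sup>* \<rightarrow> \<gg>\<close> pairs with the first component.
\<close>

definition wedge_map ::
  "(('g \<Rightarrow> 'k::comm_ring_1) \<times> ('g \<Rightarrow> 'k)) multiset \<Rightarrow> (('g \<Rightarrow> 'k) \<Rightarrow> 'k) \<Rightarrow> 'g \<Rightarrow> 'k" where
  "wedge_map t \<xi> = (\<Sum>(x, y)\<in>#t. fscale (\<xi> x) y - fscale (\<xi> y) x)"

definition wedge_bracket ::
  "('k::comm_ring_1, 'g, 'x::comm_ring) comod_alg \<Rightarrow> (('g \<Rightarrow> 'k) \<times> ('g \<Rightarrow> 'k)) multiset \<Rightarrow>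
   'x \<Rightarrow> 'x \<Rightarrow> 'x" where
  "wedge_bracket X t f g =
     (\<Sum>(x, y)\<in>#t. inf_act X x f * inf_act X y g - inf_act X y f * inf_act X x g)"

definition differ_by_twist ::
  "('k::comm_ring_1, 'd::comm_ring_1) hopf \<Rightarrow> ('k, 'g::comm_ring_1) hopf \<Rightarrow> ('d \<Rightarrow> 'g) \<Rightarrow>
   ('d \<Rightarrow> 'd \<Rightarrow> 'k) \<Rightarrow> ('d \<Rightarrow> 'k) set \<Rightarrow> ('d \<Rightarrow> 'k) set \<Rightarrow>
   (('g \<Rightarrow> 'k) \<times> ('g \<Rightarrow> 'k)) multiset \<Rightarrow> bool" where
  "differ_by_twist D G p c h1 h2 t \<longleftrightarrow>
     set_mset t \<subseteq> lie G \<times> lie G \<and>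
     (\<forall>\<alpha>\<in>dual_space (lie D).
        proj_along D G p c h2 \<alpha> - proj_along D G p c h1 \<alpha> = - wedge_map t (\<lambda>y. \<alpha> (y \<circ> p)))"

text \<open>Brackets of bivectors: alternating biderivations.\<close>

definition alternating_biderivation ::
  "('k::comm_ring_1, 'g, 'x::comm_ring) comod_alg \<Rightarrow> ('x \<Rightarrow> 'x \<Rightarrow> 'x) \<Rightarrow> bool" where
  "alternating_biderivation X br \<longleftrightarrow>
     (\<forall>f. br f f = 0) \<and>
     (\<forall>f. module_hom (cscl X) (cscl X) (br f)) \<and> (\<forall>g. module_hom (cscl X) (cscl X) (\<lambda>f. br f g)) \<and>
     (\<forall>f g h. br f (g * h) = br f g * h + g * br f h) \<and>
     (\<forall>f g h. br (f * g) h = f * br g h + br f h * g)"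

text \<open>
  The brackets \<open>{-,-}\<^sub>h\<close> of a variety over a group pair, for all Lagrangian complements \<open>h\<close>, related
  by twisting. The remaining axioms of a quasi-Poisson space (the condition on the Schouten bracket
  \<open>[\<pi>, \<pi>]\<close> and compatibility with the bivector of \<open>G\<close>) are not demanded: the first is not a
  consequence of a quantization over \<open>k[\<hbar>]/\<hbar>\<^sup>2\<close>, and neither enters the moment map equation.
\<close>

definition bracket_family ::
  "('k::comm_ring_1, 'd::comm_ring_1) hopf \<Rightarrow> ('k, 'g::comm_ring_1) hopf \<Rightarrow> ('d \<Rightarrow> 'g) \<Rightarrow>
   ('d \<Rightarrow> 'd \<Rightarrow> 'k) \<Rightarrow> ('k, 'g, 'x::comm_ring) comod_alg \<Rightarrow>
   (('d \<Rightarrow> 'k) set \<Rightarrow> 'x \<Rightarrow> 'x \<Rightarrow> 'x) \<Rightarrow> bool" where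
  "bracket_family D G p c X br \<longleftrightarrow>
     (\<forall>h. lagrangian_complement D G p c h \<longrightarrow> alternating_biderivation X (br h)) \<and>
     (\<forall>h1 h2 t. lagrangian_complement D G p c h1 \<and> lagrangian_complement D G p c h2 \<and>
        differ_by_twist D G p c h1 h2 t \<longrightarrow>
        (\<forall>f g. br h2 f g = br h1 f g - wedge_bracket X t f g))"


section \<open>Functions on the quotient and moment maps\<close>

text \<open>
  \<open>O(D/G)\<close>: functions on \<open>D\<close> invariant under right translations by \<open>G\<close>. Left translations of \<open>D\<close>
  act on it by \<open>(d.\<phi>)(x) = \<phi>(d\<^sup>-\<^sup>1 x)\<close>, i.e. by the right coaction
  \<open>\<phi> \<mapsto> \<phi>\<^sub>2 \<otimes> S(\<phi>\<^sub>1)\<close>; \<open>\<delta>\<close> is this coaction as a map into \<open>O(D/G) \<otimes> O(D)\<close>.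
\<close>

definition fun_DG ::
  "('k::comm_ring_1, 'd::comm_ring_1) hopf \<Rightarrow> ('k, 'g::comm_ring_1) hopf \<Rightarrow> ('d \<Rightarrow> 'g) \<Rightarrow>
   ('d \<Rightarrow> ('d \<times> 'd) multiset) \<Rightarrow> ('k, 'd, 'd) comod_alg" where
  "fun_DG D G p \<delta> =
     \<lparr>carr = {\<phi>. tensor_eq UNIV (scl D) UNIV (scl G)
                   (\<Sum>(a, b)\<in>#comul D \<phi>. {#(a, p b)#}) {#(\<phi>, 1)#}},
      cscl = scl D, cunit = 1, coact = \<delta>\<rparr>"

definition left_translation_coaction ::
  "('k::comm_ring_1, 'd::comm_ring_1) hopf \<Rightarrow> ('k, 'g::comm_ring_1) hopf \<Rightarrow> ('d \<Rightarrow> 'g) \<Rightarrow>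
   ('d \<Rightarrow> ('d \<times> 'd) multiset) \<Rightarrow> bool" where
  "left_translation_coaction D G p \<delta> \<longleftrightarrow>
     comodule_algebra D (fun_DG D G p \<delta>) \<and>
     (\<forall>\<phi>\<in>carr (fun_DG D G p \<delta>). tensor_eq UNIV (scl D) UNIV (scl D)
        (\<delta> \<phi>) (\<Sum>(a, b)\<in>#comul D \<phi>. {#(b, antip D a)#}))"

text \<open>
  The right adjoint of corestriction along \<open>f : P \<rightarrow> H\<close> is the cotensor product with \<open>P\<close>. So
  \<open>T\<^sup>R(1)\<close> is \<open>{x. f(x\<^sub>1) \<otimes> x\<^sub>2 = 1 \<otimes> x}\<close> with the coaction induced by \<open>\<Delta>\<close> and with counit of
  adjunction \<open>\<epsilon>\<close>; the universal property is \<open>TR_unit_counit\<close> and \<open>TR_unit_universal\<close> below. The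
  lax monoidal structure gives it the product that is colinear and compatible with \<open>\<epsilon>\<close>, which is
  the product of \<open>P\<close>. Here \<open>\<delta>\<close> is the coaction as a map into \<open>T\<^sup>R(1) \<otimes> P\<close>; it exists and is
  unique modulo equality in \<open>T\<^sup>R(1) \<otimes> P\<close> because \<open>P\<close> is flat.
\<close>

definition TR_unit ::
  "('r::comm_ring_1, 'p::ring_1) hopf \<Rightarrow> ('r, 'h::ring_1) hopf \<Rightarrow> ('p \<Rightarrow> 'h) \<Rightarrow>
   ('p \<Rightarrow> ('p \<times> 'p) multiset) \<Rightarrow> ('r, 'p, 'p) comod_alg" where
  "TR_unit P H f \<delta> =
     \<lparr>carr = {x. tensor_eq UNIV (scl H) UNIV (scl P)
                   (\<Sum>(a, b)\<in>#comul P x. {#(f a, b)#}) {#(1, x)#}},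
      cscl = scl P, cunit = 1, coact = \<delta>\<rparr>"

lemma mset_cong_bind:
  assumes "mset_cong R x y"
    and "\<And>x y. R x y \<Longrightarrow> mset_cong R' (\<Sum>t\<in>#x. F t) (\<Sum>t\<in>#y. F t)"
  shows "mset_cong R' (\<Sum>t\<in>#x. F t) (\<Sum>t\<in>#y. F t)"
  using assms(1)
proof induction
  case (base x y)
  then show ?case by (rule assms(2))
next
  case (trans x y z)
  then show ?case by (meson mset_cong.trans)
qed (simp_all add: mset_cong.refl mset_cong.sym mset_cong.add)

lemma mset_cong_sum:
  assumes "mset_cong R x y" and "\<And>x y. R x y \<Longrightarrow> (\<Sum>t\<in>#x. F t) = (\<Sum>t\<in>#y. F t)"
  shows "(\<Sum>t\<in>#x. F t) = (\<Sum>t\<in>#y. F t)"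
  using assms(1) by induction (auto intro: assms(2))

lemma mset_cong_sum_cong:
  assumes "\<And>t. t \<in># u \<Longrightarrow> mset_cong R (F t) (G t)"
  shows "mset_cong R (\<Sum>t\<in>#u. F t) (\<Sum>t\<in>#u. G t)"
  using assms by (induction u) (simp_all add: mset_cong.refl mset_cong.add)

lemma sum_mset_bind: "(\<Sum>t\<in>#(\<Sum>x\<in>#u. F x). G t) = (\<Sum>x\<in>#u. \<Sum>t\<in>#F x. G t)"
  by (induction u) auto

lemma bilinear_rel_swap:
  "m \<in> M \<Longrightarrow> m' \<in> M \<Longrightarrow> n \<in> N \<Longrightarrow> bilinear_rel M s N t {#(m + m', n)#} {#(m', n), (m, n)#}"
  "m \<in> M \<Longrightarrow> n \<in> N \<Longrightarrow> n' \<in> N \<Longrightarrow> bilinear_rel M s N t {#(m, n + n')#} {#(m, n'), (m, n)#}"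
  by (subst add_mset_commute, rule bilinear_rel.add_left, assumption+)
    (subst add_mset_commute, rule bilinear_rel.add_right, assumption+)

lemma tensor_eq_sum_left:
  assumes "\<And>t. t \<in># u \<Longrightarrow> e t \<in> M" "0 \<in> M" "\<And>x y. x \<in> M \<Longrightarrow> y \<in> M \<Longrightarrow> x + y \<in> M" "n \<in> N"
  shows "tensor_eq M s N w {#((\<Sum>t\<in>#u. e t), n)#} (\<Sum>t\<in>#u. {#(e t, n)#})"
  using assms(1)
proof (induction u)
  case empty
  then show ?case
    by (auto simp: tensor_eq_def intro!: mset_cong.base bilinear_rel.zero assms)
next
  case (add t u)
  have "(\<Sum>t\<in>#v. e t) \<in> M" if "\<And>t. t \<in># v \<Longrightarrow> e t \<in> M" for v
    using that by (induction v) (auto intro: assms)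
  then have mem: "(\<Sum>t\<in>#u. e t) \<in> M"
    using add.prems by simp
  have "mset_cong (bilinear_rel M s N w) {#(e t + (\<Sum>t\<in>#u. e t), n)#} {#(e t, n), ((\<Sum>t\<in>#u. e t), n)#}"
    using mem add.prems by (intro mset_cong.base bilinear_rel.add_left assms(4)) auto
  also have "{#(e t, n), ((\<Sum>t\<in>#u. e t), n)#} = {#(e t, n)#} + {#((\<Sum>t\<in>#u. e t), n)#}"
    by simp
  finally have 1: "mset_cong (bilinear_rel M s N w) {#(e t + (\<Sum>t\<in>#u. e t), n)#}
    ({#(e t, n)#} + {#((\<Sum>t\<in>#u. e t), n)#})" .
  have 2: "mset_cong (bilinear_rel M s N w) ({#(e t, n)#} + {#((\<Sum>t\<in>#u. e t), n)#})
     ({#(e t, n)#} + (\<Sum>t\<in>#u. {#(e t, n)#}))"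
    using add by (intro mset_cong.add mset_cong.refl) (auto simp: tensor_eq_def)
  show ?case
    using mset_cong.trans[OF 1 2] by (simp add: tensor_eq_def)
qed

lemma tensor_eq_sum_right:
  assumes "\<And>t. t \<in># u \<Longrightarrow> e t \<in> N" "0 \<in> N" "\<And>x y. x \<in> N \<Longrightarrow> y \<in> N \<Longrightarrow> x + y \<in> N" "m \<in> M"
    "module s" "module w"
  shows "tensor_eq M s N w {#(m, (\<Sum>t\<in>#u. e t))#} (\<Sum>t\<in>#u. {#(m, e t)#})"
  using assms(1)
proof (induction u)
  case empty
  interpret s: module s by fact
  interpret w: module w by fact
  have "mset_cong (bilinear_rel M s N w) {#(s 0 m, 0)#} {#(m, w 0 0)#}"
    by (intro mset_cong.base bilinear_rel.balanced assms)
  moreover have "mset_cong (bilinear_rel M s N w) {#(0, 0)#} {#}"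
    by (intro mset_cong.base bilinear_rel.zero assms)
  ultimately have "mset_cong (bilinear_rel M s N w) {#(m, 0)#} {#}"
    using mset_cong.trans[OF mset_cong.sym] by fastforce
  then show ?case
    by (simp add: tensor_eq_def)
next
  case (add t u)
  have "(\<Sum>t\<in>#v. e t) \<in> N" if "\<And>t. t \<in># v \<Longrightarrow> e t \<in> N" for v
    using that by (induction v) (auto intro: assms)
  then have mem: "(\<Sum>t\<in>#u. e t) \<in> N"
    using add.prems by simp
  have "mset_cong (bilinear_rel M s N w) {#(m, e t + (\<Sum>t\<in>#u. e t))#} {#(m, e t), (m, (\<Sum>t\<in>#u. e t))#}"
    using mem add.prems by (intro mset_cong.base bilinear_rel.add_right assms(4)) auto
  also have "{#(m, e t), (m, (\<Sum>t\<in>#u. e t))#} = {#(m, e t)#} + {#(m, (\<Sum>t\<in>#u. e t))#}"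
    by simp
  finally have 1: "mset_cong (bilinear_rel M s N w) {#(m, e t + (\<Sum>t\<in>#u. e t))#}
    ({#(m, e t)#} + {#(m, (\<Sum>t\<in>#u. e t))#})" .
  have 2: "mset_cong (bilinear_rel M s N w) ({#(m, e t)#} + {#(m, (\<Sum>t\<in>#u. e t))#})
     ({#(m, e t)#} + (\<Sum>t\<in>#u. {#(m, e t)#}))"
    using add by (intro mset_cong.add mset_cong.refl) (auto simp: tensor_eq_def)
  show ?case
    using mset_cong.trans[OF 1 2] by (simp add: tensor_eq_def)
qed

lemma sum_mset_pair_cong:
  assumes "\<And>a b. (a, b) \<in># u \<Longrightarrow> F a b = G a b"
  shows "(\<Sum>(a, b)\<in>#u. F a b) = (\<Sum>(a, b)\<in>#u. G a b)"
  using assms by (auto intro!: arg_cong[where f = sum_mset] image_mset_cong)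

lemma TR_unit_counit:
  assumes P: "hopf_algebra P" and H: "hopf_algebra H" and f: "hopf_map id P H f"
    and x: "x \<in> carr (TR_unit P H f \<delta>')"
  shows "f x = scl H (counit P x) 1"
proof -
  interpret P: module "scl P" using P by (simp add: hopf_algebra_def assoc_algebra_def)
  interpret H: module "scl H" using H by (simp add: hopf_algebra_def assoc_algebra_def)
  interpret e: module_hom "scl P" "(*)" "counit P" using P by (simp add: hopf_algebra_def)
  have f_add: "f (a + b) = f a + f b" and f_scl: "f (scl P r a) = scl H r (f a)" for a b r
    using f by (auto simp: hopf_map_def)
  have f0: "f 0 = 0" using f_add[of 0 0] by simp
  have f_sum: "f (\<Sum>t\<in>#u. e t) = (\<Sum>t\<in>#u. f (e t))" for u and e :: "'x \<Rightarrow> _"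
    by (induction u) (auto simp: f_add f0)
  have "tensor_eq UNIV (scl H) UNIV (scl P) (\<Sum>(a, b)\<in>#comul P x. {#(f a, b)#}) {#(1, x)#}"
    using x by (simp add: TR_unit_def)
  then have "(\<Sum>(a, b)\<in>#(\<Sum>(a, b)\<in>#comul P x. {#(f a, b)#}). scl H (counit P b) a) =
             (\<Sum>(a, b)\<in>#{#(1, x)#}. scl H (counit P b) a)"
    unfolding tensor_eq_def
    by (rule mset_cong_sum)
       (auto elim!: bilinear_rel.cases simp: e.add e.scale H.scale_left_distrib
          H.scale_right_distrib mult.commute)
  also have "(\<Sum>(a, b)\<in>#(\<Sum>(a, b)\<in>#comul P x. {#(f a, b)#}). scl H (counit P b) a) =
             f (\<Sum>(a, b)\<in>#comul P x. scl P (counit P b) a)"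
    by (simp add: f_sum case_prod_unfold f_scl image_mset.compositionality comp_def)
  also have "(\<Sum>(a, b)\<in>#comul P x. scl P (counit P b) a) = x"
    using P by (simp add: hopf_algebra_def)
  finally show ?thesis by simp
qed

lemma TR_unit_universal:
  fixes P :: "('r::comm_ring_1, 'p::ring_1) hopf" and H :: "('r, 'h::ring_1) hopf"
    and V :: "'v::ab_group_add set" and \<delta>' :: "'p \<Rightarrow> ('p \<times> 'p) multiset"
  assumes P: "hopf_algebra P" and H: "hopf_algebra H" and f: "hopf_map id P H f"
    and V: "right_comodule P V s \<delta>"
    and \<phi>_add: "\<And>x y. x \<in> V \<Longrightarrow> y \<in> V \<Longrightarrow> \<phi> (x + y) = \<phi> x + \<phi> y"
    and \<phi>_scale: "\<And>r x. x \<in> V \<Longrightarrow> \<phi> (s r x) = r * \<phi> x"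
    and \<phi>_colinear: "\<And>x. x \<in> V \<Longrightarrow> (\<Sum>(a, h)\<in>#\<delta> x. scl H (\<phi> a) (f h)) = scl H (\<phi> x) 1"
  defines "is_lift \<equiv> \<lambda>g.
      (\<forall>x\<in>V. g x \<in> carr (TR_unit P H f \<delta>')) \<and>
      (\<forall>x\<in>V. \<forall>y\<in>V. g (x + y) = g x + g y) \<and> (\<forall>r. \<forall>x\<in>V. g (s r x) = scl P r (g x)) \<and>
      (\<forall>x\<in>V. tensor_eq UNIV (scl P) UNIV (scl P) (comul P (g x)) (\<Sum>(a, h)\<in>#\<delta> x. {#(g a, h)#})) \<and>
      (\<forall>x\<in>V. counit P (g x) = \<phi> x)"
  shows "\<exists>g. is_lift g" and "\<And>g g' x. is_lift g \<Longrightarrow> is_lift g' \<Longrightarrow> x \<in> V \<Longrightarrow> g x = g' x"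
proof -
  interpret P: module "scl P" using P by (simp add: hopf_algebra_def assoc_algebra_def)
  interpret H: module "scl H" using H by (simp add: hopf_algebra_def assoc_algebra_def)
  interpret s: module s using V by (simp add: right_comodule_def)
  interpret e: module_hom "scl P" "(*)" "counit P" using P by (simp add: hopf_algebra_def)
  have subV: "s.subspace V" using V by (simp add: right_comodule_def)
  have V0: "0 \<in> V" and Vadd: "\<And>x y. x \<in> V \<Longrightarrow> y \<in> V \<Longrightarrow> x + y \<in> V"
    and Vscale: "\<And>r x. x \<in> V \<Longrightarrow> s r x \<in> V"
    using subV by (auto simp: s.subspace_def)
  have \<delta>V: "\<And>a h x. x \<in> V \<Longrightarrow> (a, h) \<in># \<delta> x \<Longrightarrow> a \<in> V"
    using V by (auto simp: right_comodule_def)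
  have f_add: "f (a + b) = f a + f b" and f_scl: "f (scl P r a) = scl H r (f a)" for a b r
    using f by (auto simp: hopf_map_def)
  have f0: "f 0 = 0" using f_add[of 0 0] by simp
  have f_sum: "f (\<Sum>t\<in>#u. e t) = (\<Sum>t\<in>#u. f (e t))" for u and e :: "'x \<Rightarrow> _"
    by (induction u) (auto simp: f_add f0)
  have \<phi>0: "\<phi> 0 = 0" using \<phi>_add[OF V0 V0] by simp

  show "g x = g' x" if g: "is_lift g" and g': "is_lift g'" and x: "x \<in> V" for g g' x
  proof -
    have "k x = (\<Sum>(a, h)\<in>#\<delta> x. scl P (\<phi> a) h)" if k: "is_lift k" for k
    proof -
      have "tensor_eq UNIV (scl P) UNIV (scl P) (comul P (k x)) (\<Sum>(a, h)\<in>#\<delta> x. {#(k a, h)#})"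
        using k x by (auto simp: is_lift_def)
      then have "(\<Sum>(a, b)\<in>#comul P (k x). scl P (counit P a) b) =
                 (\<Sum>(a, b)\<in>#(\<Sum>(a, h)\<in>#\<delta> x. {#(k a, h)#}). scl P (counit P a) b)"
        unfolding tensor_eq_def
        by (rule mset_cong_sum)
           (auto elim!: bilinear_rel.cases simp: e.add e.scale P.scale_left_distrib
              P.scale_right_distrib mult.commute)
      also have "\<dots> = (\<Sum>(a, h)\<in>#\<delta> x. scl P (counit P (k a)) h)"
        by (simp add: case_prod_unfold image_mset.compositionality comp_def)
      also have "\<dots> = (\<Sum>(a, h)\<in>#\<delta> x. scl P (\<phi> a) h)"
        using k \<delta>V[OF x] by (intro sum_mset_pair_cong) (auto simp: is_lift_def)
      also have "(\<Sum>(a, b)\<in>#comul P (k x). scl P (counit P a) b) = k x"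
        using P by (simp add: hopf_algebra_def)
      finally show ?thesis .
    qed
    from this[OF g] this[OF g'] show ?thesis by simp
  qed

  define g where "g x = (\<Sum>(a, h)\<in>#\<delta> x. scl P (\<phi> a) h)" for x
  have eval: "(\<Sum>(a, h)\<in>#u. scl P (\<phi> a) h) = (\<Sum>(a, h)\<in>#v. scl P (\<phi> a) h)"
    if "tensor_eq V s UNIV (scl P) u v" for u v
    using that unfolding tensor_eq_def
    by (rule mset_cong_sum)
       (auto elim!: bilinear_rel.cases simp: \<phi>0 \<phi>_add \<phi>_scale P.scale_left_distrib
          P.scale_right_distrib mult.commute)
  have g_add: "g (x + y) = g x + g y" if "x \<in> V" "y \<in> V" for x y
    unfolding g_def using V that by (subst eval[of _ "\<delta> x + \<delta> y"]) (auto simp: right_comodule_def)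
  have g_scale: "g (s r x) = scl P r (g x)" if "x \<in> V" for r x
  proof -
    have "g (s r x) = (\<Sum>(a, h)\<in>#(\<Sum>(a, h)\<in>#\<delta> x. {#(s r a, h)#}). scl P (\<phi> a) h)"
      unfolding g_def using V that by (intro eval) (auto simp: right_comodule_def)
    also have "\<dots> = (\<Sum>(a, h)\<in>#\<delta> x. scl P (\<phi> (s r a)) h)"
      by (simp add: case_prod_unfold image_mset.compositionality comp_def)
    also have "\<dots> = (\<Sum>(a, h)\<in>#\<delta> x. scl P r (scl P (\<phi> a) h))"
      using \<delta>V[OF that] by (intro sum_mset_pair_cong) (auto simp: \<phi>_scale)
    also have "\<dots> = scl P r (g x)"
    proof -
      have "(\<Sum>(a, h)\<in>#u. scl P r (scl P (\<phi> a) h)) = scl P r (\<Sum>(a, h)\<in>#u. scl P (\<phi> a) h)" for u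
        by (induction u) (auto simp: P.scale_right_distrib)
      then show ?thesis by (simp add: g_def)
    qed
    finally show ?thesis .
  qed
  have g_counit: "counit P (g x) = \<phi> x" if x: "x \<in> V" for x
  proof -
    have e: "counit P (\<Sum>(a, h)\<in>#u. scl P (\<phi> a) h) = \<phi> (\<Sum>(a, h)\<in>#u. s (counit P h) a) \<and>
          (\<Sum>(a, h)\<in>#u. s (counit P h) a) \<in> V"
      if "\<And>a h. (a, h) \<in># u \<Longrightarrow> a \<in> V" for u
      using that
    proof (induction u)
      case empty
      then show ?case by (simp add: e.zero \<phi>0 V0)
    next
      case (add t u)
      obtain a h where t: "t = (a, h)" by (cases t)
      have a: "a \<in> V" using add.prems t by auto
      have IH: "counit P (\<Sum>(a, h)\<in>#u. scl P (\<phi> a) h) = \<phi> (\<Sum>(a, h)\<in>#u. s (counit P h) a)"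
        "(\<Sum>(a, h)\<in>#u. s (counit P h) a) \<in> V"
        using add.IH add.prems by auto
      show ?case using a IH
        by (auto simp: t e.add e.scale \<phi>_add Vscale Vadd \<phi>_scale mult.commute)
    qed
    have "(\<Sum>(a, h)\<in>#\<delta> x. s (counit P h) a) = x"
      using V x by (simp add: right_comodule_def)
    then show ?thesis using e[OF \<delta>V[OF x]] by (simp add: g_def)
  qed
  have comul_add: "mset_cong (bilinear_rel UNIV (scl P) UNIV (scl P)) (comul P (x + y)) (comul P x + comul P y)"
    and comul_scale: "mset_cong (bilinear_rel UNIV (scl P) UNIV (scl P)) (comul P (scl P r x))
        (\<Sum>(a, b)\<in>#comul P x. {#(scl P r a, b)#})" for x y r
    using P by (auto simp: hopf_algebra_def tensor_eq_def)
  have comul0: "mset_cong (bilinear_rel UNIV (scl P) UNIV (scl P)) (comul P 0) {#}"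
  proof -
    have "mset_cong (bilinear_rel UNIV (scl P) UNIV (scl P)) (\<Sum>(a, b)\<in>#u. {#(scl P 0 a, b)#}) {#}" for u
      using mset_cong_sum_cong[of u "bilinear_rel UNIV (scl P) UNIV (scl P)"
          "\<lambda>(a, b). {#(scl P 0 a, b)#}" "\<lambda>_. {#}"]
      by (auto intro: mset_cong.base bilinear_rel.zero)
    from mset_cong.trans[OF comul_scale[of 0 0] this] show ?thesis by simp
  qed
  have comul_sum: "mset_cong (bilinear_rel UNIV (scl P) UNIV (scl P)) (comul P (\<Sum>t\<in>#u. e t))
      (\<Sum>t\<in>#u. comul P (e t))" for u and e :: "'x \<Rightarrow> 'p"
    by (induction u)
      (simp add: comul0, simp, rule mset_cong.trans[OF comul_add mset_cong.add[OF mset_cong.refl]])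
  have g_colinear: "tensor_eq UNIV (scl P) UNIV (scl P) (comul P (g x)) (\<Sum>(a, h)\<in>#\<delta> x. {#(g a, h)#})"
    if x: "x \<in> V" for x
  proof -
    let ?R = "bilinear_rel UNIV (scl P) UNIV (scl P)"
    have 1: "mset_cong ?R (comul P (g x)) (\<Sum>t\<in>#\<delta> x. comul P (case t of (a, h) \<Rightarrow> scl P (\<phi> a) h))"
      unfolding g_def by (rule comul_sum)
    have 2: "mset_cong ?R (\<Sum>t\<in>#\<delta> x. comul P (case t of (a, h) \<Rightarrow> scl P (\<phi> a) h))
        (\<Sum>t\<in>#\<delta> x. case t of (a, h) \<Rightarrow> \<Sum>(h1, h2)\<in>#comul P h. {#(scl P (\<phi> a) h1, h2)#})"
      by (rule mset_cong_sum_cong) (auto intro: comul_scale)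
    have 3: "mset_cong ?R
        (\<Sum>t\<in>#(\<Sum>(a, h)\<in>#\<delta> x. \<Sum>(a0, a1)\<in>#\<delta> a. {#(a0, a1, h)#}).
            case t of (a, h1, h2) \<Rightarrow> {#(scl P (\<phi> a) h1, h2)#})
        (\<Sum>t\<in>#(\<Sum>(a, h)\<in>#\<delta> x. \<Sum>(h1, h2)\<in>#comul P h. {#(a, h1, h2)#}).
            case t of (a, h1, h2) \<Rightarrow> {#(scl P (\<phi> a) h1, h2)#})"
    proof (rule mset_cong_bind)
      show "mset_cong (trilinear_rel V s UNIV (scl P) UNIV (scl P))
          (\<Sum>(a, h)\<in>#\<delta> x. \<Sum>(a0, a1)\<in>#\<delta> a. {#(a0, a1, h)#})
          (\<Sum>(a, h)\<in>#\<delta> x. \<Sum>(h1, h2)\<in>#comul P h. {#(a, h1, h2)#})"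
        using V x by (auto simp: right_comodule_def tensor3_eq_def)
    next
      fix u v assume "trilinear_rel V s UNIV (scl P) UNIV (scl P) u v"
      then show "mset_cong ?R (\<Sum>t\<in>#u. case t of (a, h1, h2) \<Rightarrow> {#(scl P (\<phi> a) h1, h2)#})
         (\<Sum>t\<in>#v. case t of (a, h1, h2) \<Rightarrow> {#(scl P (\<phi> a) h1, h2)#})"
      proof cases
        case (zero n l)
        then show ?thesis by (auto simp: \<phi>0 intro!: mset_cong.base bilinear_rel.zero)
      next
        case (add1 m m' n l)
        then show ?thesis
          using bilinear_rel.add_left[of "scl P (\<phi> m) n" UNIV "scl P (\<phi> m') n" l UNIV "scl P" "scl P"]
          by (auto simp: \<phi>_add P.scale_left_distrib add_mset_commute intro!: mset_cong.base)
      next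
        case (add2 m n n' l)
        then show ?thesis
          using bilinear_rel.add_left[of "scl P (\<phi> m) n" UNIV "scl P (\<phi> m) n'" l UNIV "scl P" "scl P"]
          by (auto simp: P.scale_right_distrib add_mset_commute intro!: mset_cong.base)
      next
        case (add3 m n l l')
        then show ?thesis
          using bilinear_rel.add_right[of "scl P (\<phi> m) n" UNIV l UNIV l' "scl P" "scl P"]
          by (auto simp: add_mset_commute intro!: mset_cong.base)
      next
        case (balanced12 m n l r)
        then show ?thesis by (auto simp: \<phi>_scale mult.commute intro!: mset_cong.refl)
      next
        case (balanced23 m n l r)
        have "scl P (\<phi> m) (scl P r n) = scl P r (scl P (\<phi> m) n)" by (simp add: mult.commute)
        with balanced23 show ?thesis
          using bilinear_rel.balanced[of "scl P (\<phi> m) n" UNIV l UNIV "scl P" "scl P" r]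
          by (auto intro!: mset_cong.base simp del: P.scale_scale)
      qed
    qed
    have 4: "mset_cong ?R (\<Sum>t\<in>#\<delta> x. case t of (a, h) \<Rightarrow> {#(g a, h)#})
        (\<Sum>t\<in>#\<delta> x. case t of (a, h) \<Rightarrow> \<Sum>(a0, a1)\<in>#\<delta> a. {#(scl P (\<phi> a0) a1, h)#})"
    proof (rule mset_cong_sum_cong, clarify)
      fix a h
      have "tensor_eq UNIV (scl P) UNIV (scl P) {#((\<Sum>t\<in>#\<delta> a. case t of (a0, a1) \<Rightarrow> scl P (\<phi> a0) a1), h)#}
         (\<Sum>t\<in>#\<delta> a. {#((case t of (a0, a1) \<Rightarrow> scl P (\<phi> a0) a1), h)#})"
        by (rule tensor_eq_sum_left) auto
      then show "mset_cong ?R {#(g a, h)#} (\<Sum>(a0, a1)\<in>#\<delta> a. {#(scl P (\<phi> a0) a1, h)#})"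
        by (simp add: g_def tensor_eq_def case_prod_unfold)
    qed
    have t3: "mset_cong ?R
        (\<Sum>t\<in>#\<delta> x. case t of (a, h) \<Rightarrow> \<Sum>(a0, a1)\<in>#\<delta> a. {#(scl P (\<phi> a0) a1, h)#})
        (\<Sum>t\<in>#\<delta> x. case t of (a, h) \<Rightarrow> \<Sum>(h1, h2)\<in>#comul P h. {#(scl P (\<phi> a) h1, h2)#})"
      using 3 unfolding case_prod_unfold sum_mset_bind by simp
    show ?thesis unfolding tensor_eq_def
      by (rule mset_cong.trans[OF 1 mset_cong.trans[OF 2 mset_cong.trans[OF mset_cong.sym[OF t3]
            mset_cong.sym[OF 4]]]])
  qed
  have g_inv: "g x \<in> carr (TR_unit P H f \<delta>')" if x: "x \<in> V" for x
  proof -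
    let ?R = "bilinear_rel UNIV (scl H) UNIV (scl P)"
    have 1: "mset_cong ?R (\<Sum>t\<in>#comul P (g x). case t of (a, b) \<Rightarrow> {#(f a, b)#})
        (\<Sum>t\<in>#(\<Sum>(a, h)\<in>#\<delta> x. {#(g a, h)#}). case t of (a, b) \<Rightarrow> {#(f a, b)#})"
      using g_colinear[OF x] unfolding tensor_eq_def
      by (rule mset_cong_bind)
         (auto elim!: bilinear_rel.cases simp: f_add f_scl f0
            intro!: mset_cong.base bilinear_rel.zero bilinear_rel.balanced bilinear_rel_swap)
    have fg: "f (g a) = scl H (\<phi> a) 1" if "a \<in> V" for a
      using \<phi>_colinear[OF that] by (simp add: g_def f_sum case_prod_unfold f_scl)
    have 2: "mset_cong ?R (\<Sum>t\<in>#\<delta> x. case t of (a, h) \<Rightarrow> {#(f (g a), h)#})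
         (\<Sum>t\<in>#\<delta> x. {#(1, (case t of (a, h) \<Rightarrow> scl P (\<phi> a) h))#})"
      using \<delta>V[OF x]
      by (intro mset_cong_sum_cong) (auto simp: fg intro!: mset_cong.base bilinear_rel.balanced)
    have 3: "mset_cong ?R {#(1, g x)#} (\<Sum>t\<in>#\<delta> x. {#(1, (case t of (a, h) \<Rightarrow> scl P (\<phi> a) h))#})"
      using tensor_eq_sum_right[of "\<delta> x" "\<lambda>t. case t of (a, h) \<Rightarrow> scl P (\<phi> a) h" UNIV 1 UNIV "scl H" "scl P"]
        P.module_axioms H.module_axioms
      by (auto simp: g_def tensor_eq_def)
    have t1: "mset_cong ?R (\<Sum>t\<in>#comul P (g x). case t of (a, b) \<Rightarrow> {#(f a, b)#})
        (\<Sum>t\<in>#\<delta> x. case t of (a, h) \<Rightarrow> {#(f (g a), h)#})"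
      using 1 unfolding case_prod_unfold sum_mset_bind by simp
    have "mset_cong ?R (\<Sum>(a, b)\<in>#comul P (g x). {#(f a, b)#}) {#(1, g x)#}"
      by (rule mset_cong.trans[OF t1 mset_cong.trans[OF 2 mset_cong.sym[OF 3]]])
    then show ?thesis by (simp add: TR_unit_def tensor_eq_def)
  qed
  have "is_lift g"
    using g_inv g_add g_scale g_colinear g_counit by (auto simp: is_lift_def)
  then show "\<exists>g. is_lift g" by blast
qed

definition TR_unit_coaction ::
  "('r::comm_ring_1, 'p::ring_1) hopf \<Rightarrow> ('r, 'h::ring_1) hopf \<Rightarrow> ('p \<Rightarrow> 'h) \<Rightarrow>
   ('p \<Rightarrow> ('p \<times> 'p) multiset) \<Rightarrow> bool" where
  "TR_unit_coaction P H f \<delta> \<longleftrightarrow>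
     comodule_algebra P (TR_unit P H f \<delta>) \<and>
     (\<forall>x\<in>carr (TR_unit P H f \<delta>). tensor_eq UNIV (scl P) UNIV (scl P) (\<delta> x) (comul P x))"

text \<open>
  The identification of \<open>T\<^sup>R(1)\<close> at \<open>\<hbar> = 0\<close>, i.e. of left \<open>G\<close>-invariant functions on \<open>D\<close> with the
  right regular action of \<open>D\<close>, with \<open>O(D/G)\<close> is the pullback along the inversion of \<open>D\<close>.
\<close>

definition F_to_DG :: "('k, 'd) hopf \<Rightarrow> ('p \<Rightarrow> 'd) \<Rightarrow> 'p \<Rightarrow> 'd" where
  "F_to_DG D \<rho>D x = antip D (\<rho>D x)"

definition quantum_moment_map ::
  "('r::comm_ring_1, 'h::ring_1) hopf \<Rightarrow> ('p::ring_1 \<Rightarrow> 'h) \<Rightarrow> ('p \<Rightarrow> 'h \<Rightarrow> 'r) \<Rightarrow>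
   ('r, 'p, 'p) comod_alg \<Rightarrow> ('r, 'h, 'a::ring) comod_alg \<Rightarrow> ('p \<Rightarrow> 'a) \<Rightarrow> bool" where
  "quantum_moment_map HG ph RG F A \<mu>h \<longleftrightarrow>
     comod_alg_map id HG ph F A \<mu>h \<and>
     (\<forall>h\<in>carr F. \<forall>b\<in>carr A.
        \<mu>h h * b =
        (\<Sum>(h0, h1)\<in>#coact F h. \<Sum>(b0, b1)\<in>#coact A b. cscl A (RG h1 b1) (b0 * \<mu>h h0)))"

text \<open>
  \<open>E\<close> is a basis of \<open>\<dd>\<close>; \<^const>\<open>module.representation\<close> gives the coordinate functions, i.e. the
  dual basis. The map \<open>\<mu>\<close> is given by its pullback \<open>O(D/G) \<rightarrow> O(X)\<close>.
\<close>

definition dual_basis :: "('d \<Rightarrow> 'k::comm_ring_1) set \<Rightarrow> ('d \<Rightarrow> 'k) \<Rightarrow> ('d \<Rightarrow> 'k) \<Rightarrow> 'k" where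
  "dual_basis E e = (\<lambda>x. module.representation fscale E x e)"

definition classical_moment_map ::
  "('k::comm_ring_1, 'd::comm_ring_1) hopf \<Rightarrow> ('k, 'g::comm_ring_1) hopf \<Rightarrow> ('d \<Rightarrow> 'g) \<Rightarrow>
   ('d \<Rightarrow> 'd \<Rightarrow> 'k) \<Rightarrow> ('d \<Rightarrow> 'k) set \<Rightarrow> ('k, 'd, 'd) comod_alg \<Rightarrow>
   ('k, 'g, 'x::comm_ring) comod_alg \<Rightarrow> (('d \<Rightarrow> 'k) set \<Rightarrow> 'x \<Rightarrow> 'x \<Rightarrow> 'x) \<Rightarrow>
   ('d \<Rightarrow> 'x) \<Rightarrow> bool" where
  "classical_moment_map D G p c E Q X br \<mu> \<longleftrightarrow>
     comod_alg_map id G p Q X \<mu> \<and>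
     (\<exists>h. lagrangian_complement D G p c h \<and>
        (\<forall>f1\<in>carr Q. \<forall>f2\<in>carr X.
           br h (\<mu> f1) f2 =
           (\<Sum>e\<in>E. \<mu> (inf_act Q e f1) * inf_act X (proj_along D G p c h (dual_basis E e)) f2)))"

end

theory Submission
  imports Defs
begin

text \<open>
  Write the commutator of \<open>\<mu>\<^sub>\<hbar>(f)\<close> and \<open>b\<close> with the quantum moment map equation: the part \<open>\<epsilon> \<otimes> \<epsilon>\<close> of
  \<open>\<^bold>r\<^sub>G\<close> contributes \<open>b \<mu>\<^sub>\<hbar>(f)\<close>, so that \<open>{\<mu>\<^sup>*f, b}\<close> is \<open>r\<^sub>G(f\<^sub>1, b\<^sub>1) b\<^sub>0 \<mu>\<^sup>*(f\<^sub>0)\<close>. Expanding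
  \<open>r\<^sub>G = \<Sum> e\<^sub>i \<otimes> r\<^sub>1(e\<^sup>i)\<close> turns this into \<open>\<Sum> \<mu>\<^sup>*(e\<^sub>i.f) r\<^sub>1(e\<^sup>i).b\<close>, so everything rests on
  \<open>r\<^sub>1 = p\<^sub>\<hh>\<close> for the image \<open>\<hh>\<close> of \<open>r\<^sub>2\<close>. Contracting \<open>c = r + r\<^sub>2\<^sub>1\<close> with \<open>\<alpha>\<close> in \<open>\<dd>\<^sup>*\<close> gives
  \<open>c(\<alpha>) = r\<^sub>1(\<alpha>) + r\<^sub>2(\<alpha>|\<^sub>\<gg>)\<close>. Since \<open>\<gg>\<close> is Lagrangian, \<open>c(\<alpha>)\<close> lies in \<open>\<gg>\<close> iff \<open>\<alpha>|\<^sub>\<gg> = 0\<close>; hence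
  \<open>r\<^sub>2\<close> splits \<open>\<dd> \<rightarrow> \<dd>/\<gg>\<close>, restriction \<open>\<dd>\<^sup>* \<rightarrow> \<gg>\<^sup>*\<close> is onto even over a ring \<open>k\<close>, and
  \<open>\<dd> = \<gg> \<oplus> \<hh>\<close> with \<open>\<hh>\<close> Lagrangian.
\<close>

section \<open>Tensor products and bilinear forms\<close>

lemma additive_sum_mset:
  fixes f :: "'a::ab_group_add \<Rightarrow> 'b::ab_group_add"
  assumes "\<And>x y. f (x + y) = f x + f y"
  shows "f (\<Sum>t\<in>#u. F t) = (\<Sum>t\<in>#u. f (F t))"
  using assms assms[of 0 0] by (induction u) simp_all

lemma additive_sum_mset_pair:
  fixes f :: "'a::ab_group_add \<Rightarrow> 'b::ab_group_add"
  assumes "\<And>x y. f (x + y) = f x + f y"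
  shows "f (\<Sum>(a, b)\<in>#u. F a b) = (\<Sum>(a, b)\<in>#u. f (F a b))"
  using additive_sum_mset[of f "\<lambda>(a, b). F a b" u, OF assms] by (simp add: case_prod_unfold)

text \<open>Additivity on a submodule is all that maps such as \<open>\<mu>\<close> and
  \<open>\<mu>h\<close> satisfy, so their sums may only be split once the summands are known to lie
  there.\<close>

lemma additive_on_sum_mset:
  fixes f :: "'a::ab_group_add \<Rightarrow> 'b::ab_group_add"
  assumes "module s" "module.subspace s M"
    and add: "\<And>x y. x \<in> M \<Longrightarrow> y \<in> M \<Longrightarrow> f (x + y) = f x + f y"
    and "\<And>t. t \<in># u \<Longrightarrow> F t \<in> M"
  shows "f (\<Sum>t\<in>#u. F t) = (\<Sum>t\<in>#u. f (F t))"
proof -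
  interpret module s by fact
  note M = assms(2)
  have "f 0 = 0"
    using add[OF subspace_0[OF M] subspace_0[OF M]] by simp
  then have "(\<Sum>t\<in>#u. F t) \<in> M \<and> f (\<Sum>t\<in>#u. F t) = (\<Sum>t\<in>#u. f (F t))"
    using assms(4) by (induction u) (auto simp: subspace_0[OF M] subspace_add[OF M] add)
  then show ?thesis ..
qed

lemma sum_sum_mset_swap: "(\<Sum>e\<in>E. \<Sum>t\<in>#u. F e t) = (\<Sum>t\<in>#u. \<Sum>e\<in>E. F e t)"
  for F :: "'e \<Rightarrow> 't \<Rightarrow> 'b::comm_monoid_add"
  by (induction u) (simp_all add: sum.distrib)

text \<open>The universal property of the tensor product: a balanced biadditive \<open>F\<close>
  respects each generating relation. Vanishing at 0 is a separate premise because \<open>M\<close>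
  is an arbitrary set, which might not contain 0.\<close>

lemma sum_tensor_eq:
  fixes F :: "'m::ab_group_add \<Rightarrow> 'n::ab_group_add \<Rightarrow> 'b::ab_group_add"
  assumes "tensor_eq M s N t u v"
    and "\<And>m m' n. m \<in> M \<Longrightarrow> m' \<in> M \<Longrightarrow> n \<in> N \<Longrightarrow> F (m + m') n = F m n + F m' n"
    and "\<And>m n n'. m \<in> M \<Longrightarrow> n \<in> N \<Longrightarrow> n' \<in> N \<Longrightarrow> F m (n + n') = F m n + F m n'"
    and "\<And>r m n. m \<in> M \<Longrightarrow> n \<in> N \<Longrightarrow> F (s r m) n = F m (t r n)"
    and "\<And>n. n \<in> N \<Longrightarrow> F 0 n = 0"
  shows "(\<Sum>(m, n)\<in>#u. F m n) = (\<Sum>(m, n)\<in>#v. F m n)"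
  using assms(1) unfolding tensor_eq_def
  by (rule mset_cong_sum) (auto elim!: bilinear_rel.cases simp: assms(2-5))

text \<open>The three-factor universal property; it is the form in which coassociativity gets
  applied to concrete sums.\<close>

lemma sum_tensor3_eq:
  fixes F :: "'m::ab_group_add \<Rightarrow> 'n::ab_group_add \<Rightarrow> 'l::ab_group_add \<Rightarrow> 'b::ab_group_add"
  assumes "tensor3_eq UNIV s UNIV t UNIV w u v"
    and "\<And>m m' n l. F (m + m') n l = F m n l + F m' n l"
    and "\<And>m n n' l. F m (n + n') l = F m n l + F m n' l"
    and "\<And>m n l l'. F m n (l + l') = F m n l + F m n l'"
    and "\<And>r m n l. F (s r m) n l = F m (t r n) l"
    and "\<And>r m n l. F m (t r n) l = F m n (w r l)"
  shows "(\<Sum>(m, n, l)\<in>#u. F m n l) = (\<Sum>(m, n, l)\<in>#v. F m n l)"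
proof -
  have zero: "F 0 n l = 0" for n l
    using assms(2)[of 0 0 n l] by simp
  show ?thesis
    using assms(1) unfolding tensor3_eq_def
    by (rule mset_cong_sum) (auto elim!: trilinear_rel.cases simp: assms(2-6) zero)
qed

lemma sum_mset_sum_mset_pair:
  "(\<Sum>(a, b)\<in>#(\<Sum>(x, y)\<in>#u. {#(f x y, g x y)#}). F a b) = (\<Sum>(x, y)\<in>#u. F (f x y) (g x y))"
  by (induction u) auto

section \<open>Lie algebras of functionals and their linear duals\<close>

interpretation fscale: module "fscale :: 'k::comm_ring_1 \<Rightarrow> ('a \<Rightarrow> 'k) \<Rightarrow> 'a \<Rightarrow> 'k"
  by standard (auto simp: fscale_def algebra_simps)

lemma sum_mset_apply: "(\<Sum>x\<in>#u. F x) a = (\<Sum>x\<in>#u. F x a)"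
  for F :: "'b \<Rightarrow> 'a \<Rightarrow> 'k::comm_monoid_add"
  by (induction u) auto

lemma module_scl: "hopf_algebra H \<Longrightarrow> module (scl H)"
  by (simp add: hopf_algebra_def assoc_algebra_def)

lemma lieI:
  assumes "module (scl H)"
    and "\<And>a b. x (a + b) = x a + x b" "\<And>r a. x (scl H r a) = r * x a"
    and "\<And>a b. x (a * b) = counit H a * x b + x a * counit H b"
  shows "x \<in> lie H"
  using assms by (auto simp: lie_def module_hom_iff module_def algebra_simps)

lemma
  assumes "x \<in> lie H"
  shows lie_add: "x (a + b) = x a + x b"
    and lie_scl: "x (scl H r a) = r * x a"
    and lie_mult: "x (a * b) = counit H a * x b + x a * counit H b"
    and lie_zero: "x 0 = 0"
proof -
  interpret module_hom "scl H" "(*)" x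
    using assms by (simp add: lie_def)
  show "x (a + b) = x a + x b" "x (scl H r a) = r * x a" "x 0 = 0"
    by (simp_all add: add scale zero)
  show "x (a * b) = counit H a * x b + x a * counit H b"
    using assms by (simp add: lie_def)
qed

text \<open>The Leibniz rule for 1 * 1 reads x(1) = x(1) + x(1).\<close>

lemma lie_one: "x 1 = 0" if "x \<in> lie H" "counit H 1 = 1"
  using lie_mult[OF that(1), of 1 1] that(2) by simp

lemma subspace_lie: "module.subspace fscale (lie H)" if "module (scl H)"
proof -
  have "x + y \<in> lie H" if "x \<in> lie H" "y \<in> lie H" for x y
    using that by (intro lieI \<open>module (scl H)\<close>) (auto simp: lie_add lie_scl lie_mult algebra_simps)
  moreover have "fscale c x \<in> lie H" if "x \<in> lie H" for c x
    using that by (intro lieI \<open>module (scl H)\<close>)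
      (auto simp: lie_add lie_scl lie_mult fscale_def algebra_simps)
  moreover have "0 \<in> lie H"
    by (intro lieI that) auto
  ultimately show ?thesis
    by (auto simp: fscale.subspace_def)
qed

lemma
  assumes "\<alpha> \<in> dual_space L"
  shows dual_space_add: "x \<in> L \<Longrightarrow> y \<in> L \<Longrightarrow> \<alpha> (x + y) = \<alpha> x + \<alpha> y"
    and dual_space_fscale: "x \<in> L \<Longrightarrow> \<alpha> (fscale c x) = c * \<alpha> x"
    and dual_space_outside: "x \<notin> L \<Longrightarrow> \<alpha> x = 0"
  using assms by (simp_all add: dual_space_def)

lemma dual_space_zero: "\<alpha> 0 = 0" if "\<alpha> \<in> dual_space L"
  using dual_space_fscale[OF that, of 0 0] dual_space_outside[OF that, of 0] by auto

lemma dual_space_diff: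
  assumes "\<alpha> \<in> dual_space L" "module.subspace fscale L" "x \<in> L" "y \<in> L"
  shows "\<alpha> (x - y) = \<alpha> x - \<alpha> y"
proof -
  have "x - y \<in> L" using assms fscale.subspace_diff by blast
  then show ?thesis
    using dual_space_add[OF assms(1), of "x - y" y] assms by simp
qed

lemma subspace_sum_mset:
  assumes "module.subspace fscale L" "\<And>t. t \<in># u \<Longrightarrow> F t \<in> L"
  shows "(\<Sum>t\<in>#u. F t) \<in> L"
  using assms(2)
  by (induction u) (auto intro: fscale.subspace_add fscale.subspace_0 assms(1))

lemma dual_space_sum_mset:
  assumes "\<alpha> \<in> dual_space L" "module.subspace fscale L" "\<And>t. t \<in># u \<Longrightarrow> F t \<in> L"
  shows "\<alpha> (\<Sum>t\<in>#u. F t) = (\<Sum>t\<in>#u. \<alpha> (F t))"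
  using assms(3)
  by (induction u)
     (simp_all add: dual_space_zero[OF assms(1)] dual_space_add[OF assms(1)]
       subspace_sum_mset[OF assms(2)])

lemma dual_space_eqI:
  assumes "\<alpha> \<in> dual_space L" "\<beta> \<in> dual_space L" "\<And>x. x \<in> L \<Longrightarrow> \<alpha> x = \<beta> x"
  shows "\<alpha> = \<beta>"
proof
  show "\<alpha> x = \<beta> x" for x
    using assms by (cases "x \<in> L") (simp_all add: dual_space_outside)
qed

section \<open>Contraction of tensors with covectors\<close>

lemma tensor_rep:
  assumes "r \<in> tensor_forms L M"
  shows "set_mset (tensor_rep L M r) \<subseteq> L \<times> M" "form_of (tensor_rep L M r) = r"
  using assms someI_ex[of "\<lambda>u. set_mset u \<subseteq> L \<times> M \<and> form_of u = r"]
  by (auto simp: tensor_forms_def tensor_rep_def)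

text \<open>\<open>contract1\<close> and \<open>contract2\<close> are defined through an arbitrary
  representative of \<open>r\<close>. Writing the slices of \<open>r\<close> as combinations of its
  components yields formulas that are free of this choice.\<close>

lemma
  assumes "r \<in> tensor_forms L M"
  shows tensor_forms_left: "module.subspace fscale L \<Longrightarrow> (\<lambda>a. r a b) \<in> L"
    and tensor_forms_right: "module.subspace fscale M \<Longrightarrow> r a \<in> M"
    and contract1_apply: "module.subspace fscale L \<Longrightarrow> \<alpha> \<in> dual_space L \<Longrightarrow>
      contract1 L M r \<alpha> = (\<lambda>b. \<alpha> (\<lambda>a. r a b))"
    and contract2_apply: "module.subspace fscale M \<Longrightarrow> \<xi> \<in> dual_space M \<Longrightarrow>
      contract2 L M r \<xi> = (\<lambda>a. \<xi> (r a))"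
    and contract1_mem: "module.subspace fscale M \<Longrightarrow> contract1 L M r \<alpha> \<in> M"
    and contract2_mem: "module.subspace fscale L \<Longrightarrow> contract2 L M r \<xi> \<in> L"
proof -
  define u where "u = tensor_rep L M r"
  have u: "x \<in> L" "y \<in> M" if "(x, y) \<in># u" for x y
    using tensor_rep(1)[OF assms] that by (auto simp: u_def)
  have u': "fst t \<in> L" "snd t \<in> M" if "t \<in># u" for t
    using u[of "fst t" "snd t"] that by auto
  have r_eq: "r a b = (\<Sum>(x, y)\<in>#u. x a * y b)" for a b
    using tensor_rep(2)[OF assms] by (metis form_of_def u_def)
  have left: "(\<lambda>a. r a b) = (\<Sum>(x, y)\<in>#u. fscale (y b) x)" for b
    by (auto simp: r_eq sum_mset_apply fscale_def case_prod_unfold mult.commute)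
  have right: "r a = (\<Sum>(x, y)\<in>#u. fscale (x a) y)" for a
    by (auto simp: r_eq sum_mset_apply fscale_def case_prod_unfold)
  show "(\<lambda>a. r a b) \<in> L" if L: "module.subspace fscale L" for b
    unfolding left case_prod_unfold by (intro subspace_sum_mset L fscale.subspace_scale u')
  show "r a \<in> M" if M: "module.subspace fscale M" for a
    unfolding right case_prod_unfold by (intro subspace_sum_mset M fscale.subspace_scale u')
  show "contract1 L M r \<alpha> \<in> M" if M: "module.subspace fscale M" for \<alpha>
    unfolding contract1_def u_def[symmetric] case_prod_unfold
    by (intro subspace_sum_mset M fscale.subspace_scale u')
  show "contract2 L M r \<xi> \<in> L" if L: "module.subspace fscale L" for \<xi>
    unfolding contract2_def u_def[symmetric] case_prod_unfold
    by (intro subspace_sum_mset L fscale.subspace_scale u')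
  show "contract1 L M r \<alpha> = (\<lambda>b. \<alpha> (\<lambda>a. r a b))"
    if L: "module.subspace fscale L" and \<alpha>: "\<alpha> \<in> dual_space L" for \<alpha>
  proof
    fix b
    have "\<alpha> (\<lambda>a. r a b) = (\<Sum>(x, y)\<in>#u. \<alpha> (fscale (y b) x))"
      unfolding left case_prod_unfold
      using dual_space_sum_mset[OF \<alpha> L, of u "\<lambda>t. fscale (snd t b) (fst t)"] u' L
      by (simp add: fscale.subspace_scale)
    also have "\<dots> = (\<Sum>(x, y)\<in>#u. \<alpha> x * y b)"
      using u by (intro sum_mset_pair_cong) (auto simp: dual_space_fscale[OF \<alpha>])
    finally show "contract1 L M r \<alpha> b = \<alpha> (\<lambda>a. r a b)"
      by (simp add: contract1_def u_def sum_mset_apply fscale_def case_prod_unfold)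
  qed
  show "contract2 L M r \<xi> = (\<lambda>a. \<xi> (r a))"
    if M: "module.subspace fscale M" and \<xi>: "\<xi> \<in> dual_space M" for \<xi>
  proof
    fix a
    have "\<xi> (r a) = (\<Sum>(x, y)\<in>#u. \<xi> (fscale (x a) y))"
      unfolding right case_prod_unfold
      using dual_space_sum_mset[OF \<xi> M, of u "\<lambda>t. fscale (fst t a) (snd t)"] u' M
      by (simp add: fscale.subspace_scale)
    also have "\<dots> = (\<Sum>(x, y)\<in>#u. \<xi> y * x a)"
      using u by (intro sum_mset_pair_cong) (auto simp: dual_space_fscale[OF \<xi>])
    finally show "contract2 L M r \<xi> a = \<xi> (r a)"
      by (simp add: contract2_def u_def sum_mset_apply fscale_def case_prod_unfold)
  qed
qed

text \<open>For a representative of \<open>r\<close> as a sum of pairs (x, y), both sides are the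
  sum of the products \<open>\<alpha> x * \<xi> y\<close>. This gives the symmetry of
  \<open>sharp\<close> and the isotropy of \<open>hh\<close>.\<close>

lemma contract_commute:
  assumes r: "r \<in> tensor_forms L M" and L: "module.subspace fscale L" and M: "module.subspace fscale M"
    and \<alpha>: "\<alpha> \<in> dual_space L" and \<xi>: "\<xi> \<in> dual_space M"
  shows "\<alpha> (\<lambda>a. \<xi> (r a)) = \<xi> (\<lambda>b. \<alpha> (\<lambda>a. r a b))"
proof -
  define u where "u = tensor_rep L M r"
  have u: "x \<in> L" "y \<in> M" if "(x, y) \<in># u" for x y
    using tensor_rep(1)[OF r] that by (auto simp: u_def)
  have u': "fst t \<in> L" "snd t \<in> M" if "t \<in># u" for t
    using u[of "fst t" "snd t"] that by auto
  have "\<alpha> (\<lambda>a. \<xi> (r a)) = \<alpha> (\<Sum>t\<in>#u. fscale (\<xi> (snd t)) (fst t))"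
    using contract2_apply[OF r M \<xi>] by (simp add: contract2_def u_def case_prod_unfold)
  also have "\<dots> = (\<Sum>t\<in>#u. \<xi> (snd t) * \<alpha> (fst t))"
    using dual_space_sum_mset[OF \<alpha> L, of u "\<lambda>t. fscale (\<xi> (snd t)) (fst t)"] u' L
    by (auto simp: fscale.subspace_scale dual_space_fscale[OF \<alpha>]
        intro!: arg_cong[where f = sum_mset] image_mset_cong)
  also have "\<dots> = \<xi> (\<Sum>t\<in>#u. fscale (\<alpha> (fst t)) (snd t))"
    using dual_space_sum_mset[OF \<xi> M, of u "\<lambda>t. fscale (\<alpha> (fst t)) (snd t)"] u' M
    by (auto simp: fscale.subspace_scale dual_space_fscale[OF \<xi>] mult.commute
        intro!: arg_cong[where f = sum_mset] image_mset_cong)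
  also have "\<dots> = \<xi> (\<lambda>b. \<alpha> (\<lambda>a. r a b))"
    using contract1_apply[OF r L \<alpha>] by (simp add: contract1_def u_def case_prod_unfold)
  finally show ?thesis .
qed

section \<open>The Lagrangian complement of an r-matrix\<close>

lemma subspace_dual_space: "module.subspace fscale (dual_space L)"
  by (auto simp: fscale.subspace_def dual_space_def fscale_def algebra_simps)

lemma dual_spaceI:
  assumes "\<And>x y. x \<in> L \<Longrightarrow> y \<in> L \<Longrightarrow> \<alpha> (x + y) = \<alpha> x + \<alpha> y"
    and "\<And>c x. x \<in> L \<Longrightarrow> \<alpha> (fscale c x) = c * \<alpha> x" "\<And>x. x \<notin> L \<Longrightarrow> \<alpha> x = 0"
  shows "\<alpha> \<in> dual_space L"
  using assms by (simp add: dual_space_def)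

lemma lie_comp: "y \<circ> p \<in> lie D"
  if p: "hopf_map id D G p" and "module (scl D)" and y: "y \<in> lie G"
  using p
  by (intro lieI that) (simp_all add: hopf_map_def lie_add[OF y] lie_scl[OF y] lie_mult[OF y])

text \<open>The linear algebra is separated from the quantization: of \<open>r\<close> it is only
  retained that it lies in \<dd> \<otimes> \<gg> and that its symmetrization, after pulling \<gg>
  back into \<dd>, is the \<open>c\<close> of a group pair.\<close>

locale lagrangian_r_matrix =
  fixes D :: "('k::comm_ring_1, 'd::comm_ring_1) hopf"
    and G :: "('k, 'g::comm_ring_1) hopf"
    and p :: "'d \<Rightarrow> 'g"
    and r :: "'d \<Rightarrow> 'g \<Rightarrow> 'k"
    and c :: "'d \<Rightarrow> 'd \<Rightarrow> 'k"
  assumes pair: "group_pair D G p c"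
    and r_tensor: "r \<in> tensor_forms (lie D) (lie G)"
    and c_eq: "c a b = r a (p b) + r b (p a)"
begin

definition r1 :: "(('d \<Rightarrow> 'k) \<Rightarrow> 'k) \<Rightarrow> 'g \<Rightarrow> 'k" where
  "r1 \<alpha> = (\<lambda>b. \<alpha> (\<lambda>a. r a b))"

definition r2 :: "(('g \<Rightarrow> 'k) \<Rightarrow> 'k) \<Rightarrow> 'd \<Rightarrow> 'k" where
  "r2 \<xi> = (\<lambda>a. \<xi> (r a))"

text \<open>Restriction of covectors from \<dd> to \<gg>, extended by zero to match the convention
  of \<open>dual_space\<close>.\<close>

definition restr :: "(('d \<Rightarrow> 'k) \<Rightarrow> 'k) \<Rightarrow> ('g \<Rightarrow> 'k) \<Rightarrow> 'k" where
  "restr \<alpha> = (\<lambda>y. if y \<in> lie G then \<alpha> (y \<circ> p) else 0)"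

abbreviation "gg \<equiv> sub_lie G p"
abbreviation "hh \<equiv> quantum_complement D G r"

lemma p_surj: "surj p" and p_hopf: "hopf_map id D G p"
  and module_D: "module (scl D)" and module_G: "module (scl G)"
  using pair by (auto simp: group_pair_def closed_subgroup_def affine_algebraic_group_def module_scl)

lemmas subspace_D = subspace_lie[OF module_D]
lemmas subspace_G = subspace_lie[OF module_G]
lemmas comp_p_lie = lie_comp[OF p_hopf module_D]

lemma c_tensor: "c \<in> tensor_forms (lie D) (lie D)" and c_sym: "c a b = c b a"
  using pair by (auto simp: group_pair_def)

lemma comp_p_inject: "y \<circ> p = y' \<circ> p \<longleftrightarrow> y = y'"
  using p_surj by (auto simp: fun_eq_iff surj_def) metis

lemma r1_lie: "r1 \<alpha> \<in> lie G" if "\<alpha> \<in> dual_space (lie D)"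
  using contract1_mem[OF r_tensor subspace_G, of \<alpha>]
  by (simp add: contract1_apply[OF r_tensor subspace_D that] r1_def)

lemma r2_lie: "r2 \<xi> \<in> lie D" if "\<xi> \<in> dual_space (lie G)"
  using contract2_mem[OF r_tensor subspace_D, of \<xi>]
  by (simp add: contract2_apply[OF r_tensor subspace_G that] r2_def)

lemma comp_p_add: "((x + y) \<circ> p) = (x \<circ> p) + (y \<circ> p)" and comp_p_fscale: "(fscale s x \<circ> p) = fscale s (x \<circ> p)"
  by (auto simp: fscale_def)

lemma restr_dual: "restr \<alpha> \<in> dual_space (lie G)" if \<alpha>: "\<alpha> \<in> dual_space (lie D)"
  using fscale.subspace_add[OF subspace_G] fscale.subspace_scale[OF subspace_G]
  by (auto simp: dual_space_def restr_def comp_p_add comp_p_fscale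
      dual_space_add[OF \<alpha>] dual_space_fscale[OF \<alpha>] comp_p_lie)

lemma sharp_apply: "sharp D c \<alpha> = (\<lambda>b. \<alpha> (c b))" if "\<alpha> \<in> dual_space (lie D)"
proof -
  have "(\<lambda>a. c a b) = c b" for b using c_sym by auto
  then show ?thesis
    using contract1_apply[OF c_tensor subspace_D that] by (simp add: sharp_def)
qed

lemma sharp_eq: "sharp D c \<alpha> = (r1 \<alpha> \<circ> p) + r2 (restr \<alpha>)" if \<alpha>: "\<alpha> \<in> dual_space (lie D)"
proof
  fix b
  \<comment> \<open>By symmetry of \<open>c\<close>, its slice at \<open>b\<close> splits into a
    slice of \<open>r\<close> in \<dd>, on which \<alpha> gives \<open>r1\<close>, and the pullback
    of a slice in \<gg>, which only sees the restriction of \<alpha> and gives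
    \<open>r2\<close>.\<close>
  have "c b = (\<lambda>a. r a (p b)) + (r b \<circ> p)"
    using c_eq c_sym by (auto simp: fun_eq_iff)
  moreover have "(\<lambda>a. r a (p b)) \<in> lie D" "r b \<in> lie G"
    using tensor_forms_left[OF r_tensor subspace_D] tensor_forms_right[OF r_tensor subspace_G] by auto
  ultimately show "sharp D c \<alpha> b = ((r1 \<alpha> \<circ> p) + r2 (restr \<alpha>)) b"
    using dual_space_add[OF \<alpha>, of "\<lambda>a. r a (p b)" "(r b \<circ> p)"]
    by (simp add: sharp_apply[OF \<alpha>] r1_def r2_def restr_def comp_p_lie)
qed

lemma bij_sharp: "bij_betw (sharp D c) (dual_space (lie D)) (lie D)"
  using pair by (auto simp: group_pair_def nondegenerate_def)

lemma sharp_lie: "\<alpha> \<in> dual_space (lie D) \<Longrightarrow> sharp D c \<alpha> \<in> lie D"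
  using bij_betwE[OF bij_sharp] by blast

lemma sharp_cases:
  assumes "x \<in> lie D"
  obtains \<alpha> where "\<alpha> \<in> dual_space (lie D)" "sharp D c \<alpha> = x"
  using assms bij_sharp that by (metis bij_betw_def imageE)

lemma inv_sharp: "\<alpha> \<in> dual_space (lie D) \<Longrightarrow> inv_into (dual_space (lie D)) (sharp D c) (sharp D c \<alpha>) = \<alpha>"
  using bij_sharp by (auto simp: bij_betw_def)

lemma pairing_sharp: "\<alpha> \<in> dual_space (lie D) \<Longrightarrow> pairing D c (sharp D c \<alpha>) y = \<alpha> y"
  by (simp add: pairing_def inv_sharp)

lemma sharp_commute:
  "\<alpha> (sharp D c \<beta>) = \<beta> (sharp D c \<alpha>)" if "\<alpha> \<in> dual_space (lie D)" "\<beta> \<in> dual_space (lie D)"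
proof -
  have "(\<lambda>a. c a b) = c b" for b using c_sym by auto
  then show ?thesis
    using contract_commute[OF c_tensor subspace_D subspace_D that] by (simp add: sharp_apply that)
qed

lemma gg_lagrangian: "lagrangian D c gg"
  using pair by (simp add: group_pair_def)

lemma subspace_gg: "module.subspace fscale gg"
  using gg_lagrangian by (simp add: lagrangian_def)

lemma comp_p_gg: "y \<in> lie G \<Longrightarrow> (y \<circ> p) \<in> gg"
  by (simp add: sub_lie_def)

text \<open>Pairing with \<open>sharp D c \<alpha>\<close> is evaluation of \<alpha>. As \<gg>
  equals its own orthogonal, membership in it means that \<alpha> vanishes on \<gg>.\<close>

lemma sharp_gg_iff:
  assumes \<alpha>: "\<alpha> \<in> dual_space (lie D)"
  shows "sharp D c \<alpha> \<in> gg \<longleftrightarrow> restr \<alpha> = 0"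
proof -
  have "{x \<in> lie D. \<forall>y\<in>gg. pairing D c x y = 0} = gg"
    using gg_lagrangian by (simp add: lagrangian_def)
  then have "sharp D c \<alpha> \<in> gg \<longleftrightarrow> (\<forall>y\<in>gg. pairing D c (sharp D c \<alpha>) y = 0)"
    using sharp_lie[OF \<alpha>] by blast
  also have "\<dots> \<longleftrightarrow> (\<forall>y\<in>lie G. \<alpha> (y \<circ> p) = 0)"
    by (simp add: pairing_sharp[OF \<alpha>] sub_lie_def)
  finally show ?thesis by (auto simp: restr_def fun_eq_iff)
qed

lemma r2_zero: "r2 0 = 0"
  by (simp add: r2_def fun_eq_iff)

text \<open>
  The extension of \<open>\<xi>\<close> is \<open>\<xi>\<close> after the projection \<open>\<dd> \<rightarrow> \<gg>\<close> along \<open>\<hh>\<close>, which is \<open>r\<^sub>1 \<circ> c\<^sup>-\<^sup>1\<close>.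
\<close>

lemma restr_surj:
  assumes \<xi>: "\<xi> \<in> dual_space (lie G)"
  obtains \<alpha> where "\<alpha> \<in> dual_space (lie D)" "restr \<alpha> = \<xi>"
proof -
  let ?inv = "inv_into (dual_space (lie D)) (sharp D c)"
  define \<alpha> where "\<alpha> x = (if x \<in> lie D then \<xi> (r1 (?inv x)) else 0)" for x
  have inv_add: "?inv (x + y) = ?inv x + ?inv y" if xy: "x \<in> lie D" "y \<in> lie D" for x y
  proof -
    obtain \<beta> \<gamma> where b: "\<beta> \<in> dual_space (lie D)" "sharp D c \<beta> = x" "\<gamma> \<in> dual_space (lie D)" "sharp D c \<gamma> = y"
      using xy by (metis sharp_cases)
    have m: "\<beta> + \<gamma> \<in> dual_space (lie D)"
      using b fscale.subspace_add[OF subspace_dual_space] by blast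
    have "sharp D c (\<beta> + \<gamma>) = x + y"
      using b m by (auto simp: sharp_apply)
    then show ?thesis using inv_sharp m b by metis
  qed
  have inv_scale: "?inv (fscale s x) = fscale s (?inv x)" if x: "x \<in> lie D" for s x
  proof -
    obtain \<beta> where b: "\<beta> \<in> dual_space (lie D)" "sharp D c \<beta> = x"
      using x by (metis sharp_cases)
    have m: "fscale s \<beta> \<in> dual_space (lie D)"
      using b fscale.subspace_scale[OF subspace_dual_space] by blast
    have "sharp D c (fscale s \<beta>) = fscale s x"
      using b m by (auto simp: sharp_apply fscale_def)
    then show ?thesis using inv_sharp m b by metis
  qed
  have inv_mem: "?inv x \<in> dual_space (lie D)" if "x \<in> lie D" for x
    using that inv_sharp by (metis sharp_cases)
  have r1_add: "r1 (\<beta> + \<gamma>) = r1 \<beta> + r1 \<gamma>" and r1_scale: "r1 (fscale s \<beta>) = fscale s (r1 \<beta>)" for \<beta> \<gamma> s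
    by (auto simp: r1_def fscale_def)
  have \<alpha>: "\<alpha> \<in> dual_space (lie D)"
    using fscale.subspace_add[OF subspace_D] fscale.subspace_scale[OF subspace_D]
    by (auto intro!: dual_spaceI simp: \<alpha>_def inv_add inv_scale r1_add r1_scale
        dual_space_add[OF \<xi>] dual_space_fscale[OF \<xi>] r1_lie inv_mem)
  have "restr \<alpha> = \<xi>"
  proof (rule dual_space_eqI[OF restr_dual[OF \<alpha>] \<xi>])
    fix y assume y: "y \<in> lie G"
    obtain \<beta> where b: "\<beta> \<in> dual_space (lie D)" "sharp D c \<beta> = y \<circ> p"
      using sharp_cases[OF comp_p_lie[OF y]] .
    \<comment> \<open>The element \<open>y \<circ> p\<close> lies in \<gg>, so the \<open>r2\<close>
      summand of \<open>sharp_eq\<close> drops out and \<open>r1 \<beta>\<close> recovers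
      \<open>y\<close>.\<close>
    have "restr \<beta> = 0"
      using sharp_gg_iff[OF b(1)] b(2) comp_p_gg[OF y] by simp
    then have "r1 \<beta> \<circ> p = y \<circ> p"
      using sharp_eq[OF b(1)] b(2) by (simp add: r2_zero)
    then have "r1 \<beta> = y" by (simp add: comp_p_inject)
    moreover have "?inv (y \<circ> p) = \<beta>" using inv_sharp b by metis
    ultimately show "restr \<alpha> y = \<xi> y"
      using y comp_p_lie[OF y] by (simp add: restr_def \<alpha>_def)
  qed
  then show ?thesis using that \<alpha> by blast
qed

section \<open>The image of \<open>r2\<close> as a Lagrangian complement\<close>

lemma hh_eq: "hh = r2 ` dual_space (lie G)"
  unfolding quantum_complement_def r2_def
  by (intro image_cong HOL.refl contract2_apply[OF r_tensor subspace_G])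

lemma r2_restr_hh: "\<alpha> \<in> dual_space (lie D) \<Longrightarrow> r2 (restr \<alpha>) \<in> hh"
  by (simp add: hh_eq restr_dual)

text \<open>Since restriction of covectors is onto, every element of \<open>hh\<close> occurs as the
  second summand in \<open>sharp_eq\<close> for some covector on \<dd>.\<close>

lemma hh_cases:
  assumes "z \<in> hh"
  obtains \<alpha> where "\<alpha> \<in> dual_space (lie D)" "z = r2 (restr \<alpha>)"
  using assms restr_surj unfolding hh_eq by blast

lemma subspace_hh: "module.subspace fscale hh"
proof -
  have "r2 \<xi> + r2 \<eta> = r2 (\<xi> + \<eta>)" "fscale s (r2 \<xi>) = r2 (fscale s \<xi>)" for \<xi> \<eta> s
    by (auto simp: r2_def fscale_def)
  then show ?thesis
    using fscale.subspace_add[OF subspace_dual_space[of "lie G"]]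
      fscale.subspace_scale[OF subspace_dual_space[of "lie G"]]
      imageI[OF fscale.subspace_0[OF subspace_dual_space[of "lie G"]], of r2]
    unfolding fscale.subspace_def hh_eq by (auto simp: r2_zero)
qed

lemma hh_lie: "hh \<subseteq> lie D"
  by (auto simp: hh_eq r2_lie)

text \<open>If \<open>r2 (restr \<alpha>)\<close> lies in \<gg>, then by \<open>sharp_eq\<close> so
  does \<open>sharp D c \<alpha>\<close>. Hence \<open>restr \<alpha>\<close> is zero, and the
  element is \<open>r2 0\<close>.\<close>

lemma gg_inter_hh: "gg \<inter> hh = {0}"
proof -
  have "z = 0" if "z \<in> gg" "z \<in> hh" for z
  proof -
    obtain \<alpha> where \<alpha>: "\<alpha> \<in> dual_space (lie D)" "z = r2 (restr \<alpha>)"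
      using hh_cases \<open>z \<in> hh\<close> by blast
    have "sharp D c \<alpha> \<in> gg"
      unfolding sharp_eq[OF \<alpha>(1)] \<alpha>(2)[symmetric]
      by (intro fscale.subspace_add[OF subspace_gg] that comp_p_gg r1_lie \<alpha>)
    then show "z = 0" using \<alpha> by (simp add: sharp_gg_iff r2_zero)
  qed
  then show ?thesis
    using fscale.subspace_0 subspace_gg subspace_hh by blast
qed

text \<open>The \<gg>-component of \<open>z\<close> from \<open>sharp_eq\<close> is a difference of
  elements of \<open>hh\<close>, so the trivial intersection forces it to vanish.\<close>

lemma hh_sharp:
  assumes z: "z \<in> hh"
  obtains \<alpha> where "\<alpha> \<in> dual_space (lie D)" "z = sharp D c \<alpha>" "r1 \<alpha> = 0"
proof -
  obtain \<alpha> where \<alpha>: "\<alpha> \<in> dual_space (lie D)" "sharp D c \<alpha> = z"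
    using sharp_cases z hh_lie by blast
  have "r1 \<alpha> \<circ> p = z - r2 (restr \<alpha>)"
    using sharp_eq[OF \<alpha>(1)] \<alpha>(2) by simp
  then have "r1 \<alpha> \<circ> p \<in> hh"
    using fscale.subspace_diff[OF subspace_hh z r2_restr_hh[OF \<alpha>(1)]] by simp
  \<comment> \<open>Zero is written as a pullback so that injectivity of composition with the
    surjective \<open>p\<close> applies.\<close>
  then have "r1 \<alpha> \<circ> p = 0 \<circ> p"
    using gg_inter_hh comp_p_gg[OF r1_lie[OF \<alpha>(1)]] by (fastforce simp: zero_fun_def comp_def)
  then have "r1 \<alpha> = 0"
    unfolding comp_p_inject .
  then show ?thesis using that \<alpha> by blast
qed

text \<open>Moving the contraction across \<open>r\<close> turns \<alpha>(\<open>r2 \<xi>\<close>)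
  into \<xi>(\<open>r1 \<alpha>\<close>), and \<open>r1 \<alpha>\<close> is zero for the covector of
  an element of \<open>hh\<close>.\<close>

lemma pairing_hh: "pairing D c z w = 0" if z: "z \<in> hh" and w: "w \<in> hh"
proof -
  obtain \<alpha> where \<alpha>: "\<alpha> \<in> dual_space (lie D)" "z = sharp D c \<alpha>" "r1 \<alpha> = 0"
    using hh_sharp[OF z] .
  obtain \<xi> where \<xi>: "\<xi> \<in> dual_space (lie G)" "w = r2 \<xi>"
    using w by (auto simp: hh_eq)
  have "pairing D c z w = \<alpha> (\<lambda>a. \<xi> (r a))"
    by (simp add: \<alpha> \<xi> pairing_sharp r2_def)
  also have "\<dots> = \<xi> (r1 \<alpha>)"
    unfolding r1_def by (rule contract_commute[OF r_tensor subspace_D subspace_G \<alpha>(1) \<xi>(1)])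
  also have "\<dots> = 0"
    using \<alpha>(3) dual_space_zero[OF \<xi>(1)] by simp
  finally show ?thesis .
qed

text \<open>Isotropy is \<open>pairing_hh\<close>. For maximality, subtract from \<open>x\<close>
  its \<open>hh\<close>-component \<open>z\<close>: the rest is orthogonal to \<open>hh\<close> and,
  lying in \<gg>, also to \<gg>. These span \<dd>, so its covector \<gamma> is zero.\<close>

lemma lagrangian_hh: "lagrangian D c hh"
proof -
  have "x \<in> hh" if x: "x \<in> lie D" and perp: "\<forall>y\<in>hh. pairing D c x y = 0" for x
  proof -
    obtain \<alpha> where \<alpha>: "\<alpha> \<in> dual_space (lie D)" "sharp D c \<alpha> = x"
      using sharp_cases[OF x] .
    define z where "z = r2 (restr \<alpha>)"
    have z: "z \<in> hh" using \<alpha> by (simp add: z_def r2_restr_hh)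
    have xz: "x - z = r1 \<alpha> \<circ> p"
      using sharp_eq[OF \<alpha>(1)] \<alpha>(2) by (simp add: z_def)
    have g0: "r1 \<alpha> \<circ> p \<in> lie D" "r1 \<alpha> \<circ> p \<in> gg"
      by (simp_all add: r1_lie \<alpha> comp_p_lie comp_p_gg)
    obtain \<gamma> where \<gamma>: "\<gamma> \<in> dual_space (lie D)" "sharp D c \<gamma> = x - z"
      using sharp_cases[OF g0(1)] xz by metis
    \<comment> \<open>Symmetry of \<open>sharp\<close> exchanges \<gamma> and the covector \<omega>
      of \<open>w\<close>; then \<open>x\<close> contributes zero by assumption and \<open>z\<close>
      by isotropy.\<close>
    have \<gamma>_hh: "\<gamma> w = 0" if w: "w \<in> hh" for w
    proof -
      obtain \<omega> where \<omega>: "\<omega> \<in> dual_space (lie D)" "w = sharp D c \<omega>"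
        using hh_sharp[OF w] .
      have "\<gamma> w = \<omega> (x - z)"
        using sharp_commute[OF \<gamma>(1) \<omega>(1)] \<omega>(2) \<gamma>(2) by simp
      also have "\<dots> = \<omega> x - \<omega> z"
        using dual_space_diff[OF \<omega>(1) subspace_D x] z hh_lie by blast
      also have "\<omega> x = \<alpha> w"
        using sharp_commute[OF \<alpha>(1) \<omega>(1)] \<omega>(2) \<alpha>(2) by simp
      also have "\<alpha> w = 0"
        using perp w pairing_sharp[OF \<alpha>(1)] \<alpha>(2) by auto
      also have "\<omega> z = 0"
        using pairing_hh[OF w z] pairing_sharp[OF \<omega>(1)] \<omega>(2) by auto
      finally show ?thesis by simp
    qed
    have \<gamma>_gg: "\<gamma> (y \<circ> p) = 0" if "y \<in> lie G" for y
    proof -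
      have "restr \<gamma> = 0"
        using sharp_gg_iff[OF \<gamma>(1)] \<gamma>(2) g0(2) xz by simp
      then show ?thesis
        using that by (metis restr_def zero_fun_apply)
    qed
    have "\<gamma> v = 0" if v: "v \<in> lie D" for v
    proof -
      obtain \<beta> where \<beta>: "\<beta> \<in> dual_space (lie D)" "sharp D c \<beta> = v"
        using sharp_cases[OF v] .
      have "\<gamma> v = \<gamma> (r1 \<beta> \<circ> p) + \<gamma> (r2 (restr \<beta>))"
        unfolding \<beta>(2)[symmetric] sharp_eq[OF \<beta>(1)]
        using r1_lie[OF \<beta>(1)] r2_lie[OF restr_dual[OF \<beta>(1)]]
        by (intro dual_space_add[OF \<gamma>(1)] comp_p_lie)
      then show ?thesis
        using \<gamma>_gg[OF r1_lie[OF \<beta>(1)]] \<gamma>_hh[OF r2_restr_hh[OF \<beta>(1)]] by simp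
    qed
    \<comment> \<open>The slices of \<open>c\<close> lie in \<dd>, where \<gamma> vanishes, so
      \<open>sharp D c \<gamma>\<close> is zero.\<close>
    then have "x - z = 0"
      using \<gamma>(2) tensor_forms_right[OF c_tensor subspace_D]
      by (auto simp: sharp_apply[OF \<gamma>(1)] fun_eq_iff)
    then show "x \<in> hh" using z by simp
  qed
  then show ?thesis
    using subspace_hh hh_lie pairing_hh unfolding lagrangian_def by blast
qed

lemma lagrangian_complement_hh: "lagrangian_complement D G p c hh"
proof -
  have "\<exists>x\<in>gg. \<exists>y\<in>hh. z = x + y" if "z \<in> lie D" for z
    using that sharp_cases sharp_eq comp_p_gg r1_lie r2_restr_hh by metis
  then show ?thesis
    by (simp add: lagrangian_complement_def lagrangian_hh gg_inter_hh)
qed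

text \<open>The splitting \<open>sharp_eq\<close> exhibits \<open>r1 \<alpha>\<close> as a
  \<gg>-component along \<open>hh\<close>, and the trivial intersection makes it the only one. This
  is the identity between \<open>r1\<close> and the projection.\<close>

lemma proj_along_hh:
  assumes \<alpha>: "\<alpha> \<in> dual_space (lie D)"
  shows "proj_along D G p c hh \<alpha> = (\<lambda>b. \<alpha> (\<lambda>a. r a b))"
  unfolding proj_along_def r1_def[symmetric]
proof (rule the_equality)
  show "r1 \<alpha> \<in> lie G \<and> sharp D c \<alpha> - (r1 \<alpha> \<circ> p) \<in> hh"
    by (simp add: r1_lie \<alpha> sharp_eq r2_restr_hh)
next
  fix y assume y: "y \<in> lie G \<and> sharp D c \<alpha> - (y \<circ> p) \<in> hh"
  have "(y \<circ> p) - (r1 \<alpha> \<circ> p) = r2 (restr \<alpha>) - (sharp D c \<alpha> - (y \<circ> p))"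
    by (simp add: sharp_eq[OF \<alpha>])
  then have "(y \<circ> p) - (r1 \<alpha> \<circ> p) \<in> hh"
    using fscale.subspace_diff[OF subspace_hh r2_restr_hh[OF \<alpha>]] y by metis
  moreover have "(y \<circ> p) - (r1 \<alpha> \<circ> p) \<in> gg"
    using fscale.subspace_diff[OF subspace_gg] y comp_p_gg r1_lie[OF \<alpha>] by blast
  ultimately have "(y \<circ> p) - (r1 \<alpha> \<circ> p) = 0"
    using gg_inter_hh by blast
  then show "y = r1 \<alpha>" by (simp add: comp_p_inject)
qed

end

section \<open>Invariant vector fields and the antipode\<close>

text \<open>Apply \<open>x\<close> to S(a1) a2 = \<epsilon>(a) 1, on which it vanishes. As
  \<epsilon> \<circ> S = \<epsilon>, the Leibniz rule leaves x(a) + x(S(a)).\<close>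

lemma lie_antip:
  assumes H: "hopf_algebra H" and x: "x \<in> lie H"
  shows "x (antip H a) = - x a"
proof -
  have S: "(\<Sum>(a, b)\<in>#comul H a. antip H a * b) = scl H (counit H a) 1"
    and e: "counit H (a * b) = counit H a * counit H b" "counit H 1 = 1"
    and c1: "(\<Sum>(a, b)\<in>#comul H a. scl H (counit H a) b) = a"
    and c2: "(\<Sum>(a, b)\<in>#comul H a. scl H (counit H b) a) = a"
    and eh: "module_hom (scl H) (*) (counit H)" and Sh: "module_hom (scl H) (scl H) (antip H)" for a b
    using H unfolding hopf_algebra_def by blast+
  interpret e: module_hom "scl H" "(*)" "counit H" by (rule eh)
  interpret S: module_hom "scl H" "scl H" "antip H" by (rule Sh)
  \<comment> \<open>The counit absorbs the antipode: evaluate \<epsilon> on the antipode axiom,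
    where multiplicativity and the counit axiom collapse the sum.\<close>
  have eS: "counit H (antip H a) = counit H a" for a
  proof -
    have "counit H (antip H a) = counit H (antip H (\<Sum>(a, b)\<in>#comul H a. scl H (counit H b) a))"
      by (simp only: c2)
    also have "\<dots> = (\<Sum>(a, b)\<in>#comul H a. counit H (antip H a * b))"
      by (simp add: additive_sum_mset_pair[of "antip H"] additive_sum_mset_pair[of "counit H"]
          S.add e.add S.scale e.scale e(1) mult.commute)
    also have "\<dots> = counit H (\<Sum>(a, b)\<in>#comul H a. antip H a * b)"
      by (simp add: additive_sum_mset_pair[of "counit H"] e.add)
    also have "\<dots> = counit H a"
      by (simp add: S e.scale e(2))
    finally show ?thesis .
  qed
  have "0 = x (\<Sum>(a, b)\<in>#comul H a. antip H a * b)"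
    by (simp add: S lie_scl[OF x] lie_one[OF x e(2)])
  also have "\<dots> = (\<Sum>(a, b)\<in>#comul H a. counit H a * x b) + (\<Sum>(a, b)\<in>#comul H a. x (antip H a) * counit H b)"
    by (simp add: additive_sum_mset[of x] lie_add[OF x] lie_mult[OF x] eS case_prod_unfold
        sum_mset.distrib)
  also have "(\<Sum>(a, b)\<in>#comul H a. counit H a * x b) = x (\<Sum>(a, b)\<in>#comul H a. scl H (counit H a) b)"
    by (simp add: additive_sum_mset_pair[of x] lie_add[OF x] lie_scl[OF x])
  also have "(\<Sum>(a, b)\<in>#comul H a. x (antip H a) * counit H b) =
      x (antip H (\<Sum>(a, b)\<in>#comul H a. scl H (counit H b) a))"
    by (simp add: additive_sum_mset_pair[of x] additive_sum_mset_pair[of "antip H"]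
        lie_add[OF x] lie_scl[OF x] S.add S.scale mult.commute)
  finally show ?thesis
    unfolding c1 c2 by (simp add: eq_neg_iff_add_eq_0 add.commute)
qed

text \<open>
  With \<open>U = L\<^sub>x \<circ> S\<close> and \<open>T = S \<circ> R\<^sub>x\<close>, where \<open>L\<^sub>x\<close> and \<open>R\<^sub>x\<close> are the invariant vector fields of \<open>x\<close>,
  applying the derivation \<open>L\<^sub>x\<close> to \<open>S(f\<^sub>1) f\<^sub>2 = \<epsilon>(f)\<close> gives \<open>(U + T) * id = 0\<close> for the
  convolution product, and \<open>id\<close> is invertible.
\<close>

lemma sum_comul_antip:
  fixes H :: "('r::comm_ring_1, 'h::comm_ring_1) hopf"
  assumes H: "hopf_algebra H" and x: "x \<in> lie H"
  shows "(\<Sum>(a, b)\<in>#comul H (antip H f). scl H (x (antip H a)) b) =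
    (\<Sum>(a, b)\<in>#comul H f. scl H (x b) (antip H a))"
proof -
  have alg: "assoc_algebra UNIV (scl H) 1"
    and Sl: "(\<Sum>(a, b)\<in>#comul H a. antip H a * b) = scl H (counit H a) 1"
    and Sr: "(\<Sum>(a, b)\<in>#comul H a. a * antip H b) = scl H (counit H a) 1"
    and e1: "counit H 1 = 1"
    and c1: "(\<Sum>(a, b)\<in>#comul H a. scl H (counit H a) b) = a"
    and c2: "(\<Sum>(a, b)\<in>#comul H a. scl H (counit H b) a) = a"
    and Sh: "module_hom (scl H) (scl H) (antip H)"
    and comul_add: "tensor_eq UNIV (scl H) UNIV (scl H) (comul H (a + b)) (comul H a + comul H b)"
    and comul_scl: "tensor_eq UNIV (scl H) UNIV (scl H) (comul H (scl H r a))
        (\<Sum>(a, b)\<in>#comul H a. {#(scl H r a, b)#})"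
    and comul_mult: "tensor_eq UNIV (scl H) UNIV (scl H) (comul H (f * g))
        (\<Sum>(a, b)\<in>#comul H f. \<Sum>(c, d)\<in>#comul H g. {#(a * c, b * d)#})"
    and comul_1: "tensor_eq UNIV (scl H) UNIV (scl H) (comul H 1) {#(1, 1)#}"
    and coassoc: "tensor3_eq UNIV (scl H) UNIV (scl H) UNIV (scl H)
        (\<Sum>(a, b)\<in>#comul H a. \<Sum>(a1, a2)\<in>#comul H a. {#(a1, a2, b)#})
        (\<Sum>(a, b)\<in>#comul H a. \<Sum>(b1, b2)\<in>#comul H b. {#(a, b1, b2)#})" for a b r f g
    using H unfolding hopf_algebra_def by simp_all
  interpret H: module "scl H" by (rule module_scl[OF H])
  interpret S: module_hom "scl H" "scl H" "antip H" by (rule Sh)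
  have scl_mult: "scl H r a * b = scl H r (a * b)" "a * scl H r b = scl H r (a * b)" for r a b
    using alg by (auto simp: assoc_algebra_def)
  note [simp] = lie_add[OF x] lie_scl[OF x] scl_mult S.add S.scale
  define Lx where "Lx f = (\<Sum>(a, b)\<in>#comul H f. scl H (x a) b)" for f
  define Rx where "Rx f = (\<Sum>(a, b)\<in>#comul H f. scl H (x b) a)" for f
  have Lx_add: "Lx (f + g) = Lx f + Lx g" and Rx_add: "Rx (f + g) = Rx f + Rx g" for f g
    unfolding Lx_def Rx_def
    using sum_tensor_eq[OF comul_add[of f g], of "\<lambda>a b. scl H (x a) b"]
      sum_tensor_eq[OF comul_add[of f g], of "\<lambda>a b. scl H (x b) a"]
    by (simp_all add: algebra_simps lie_zero[OF x])
  have Lx_scl: "Lx (scl H r f) = scl H r (Lx f)" and Rx_scl: "Rx (scl H r f) = scl H r (Rx f)" for r f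
    unfolding Lx_def Rx_def
    using sum_tensor_eq[OF comul_scl[of r f], of "\<lambda>a b. scl H (x a) b"]
      sum_tensor_eq[OF comul_scl[of r f], of "\<lambda>a b. scl H (x b) a"]
    by (simp_all add: algebra_simps lie_zero[OF x] sum_mset_sum_mset_pair additive_sum_mset_pair[of "scl H r"])
  have Lx_mult: "Lx (f * g) = f * Lx g + Lx f * g" for f g
  proof -
    have "Lx (f * g) = (\<Sum>(a, b)\<in>#comul H f. \<Sum>(c, d)\<in>#comul H g. scl H (x (a * c)) (b * d))"
      unfolding Lx_def
      using sum_tensor_eq[OF comul_mult[of f g], of "\<lambda>a b. scl H (x a) b"]
      by (simp add: algebra_simps lie_zero[OF x] case_prod_unfold sum_mset_bind image_mset.compositionality comp_def)
    also have "\<dots> = (\<Sum>(a, b)\<in>#comul H f. \<Sum>(c, d)\<in>#comul H g. scl H (counit H a) b * scl H (x c) d) +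
        (\<Sum>(a, b)\<in>#comul H f. \<Sum>(c, d)\<in>#comul H g. scl H (x a) b * scl H (counit H c) d)"
      by (simp add: lie_mult[OF x] H.scale_left_distrib case_prod_unfold sum_mset.distrib mult.commute)
    also have "(\<Sum>(a, b)\<in>#comul H f. \<Sum>(c, d)\<in>#comul H g. scl H (counit H a) b * scl H (x c) d) =
       (\<Sum>(a, b)\<in>#comul H f. scl H (counit H a) b) * Lx g"
      unfolding Lx_def case_prod_unfold
      by (simp only: sum_mset_distrib_right) (simp only: sum_mset_distrib_left)
    also have "(\<Sum>(a, b)\<in>#comul H f. \<Sum>(c, d)\<in>#comul H g. scl H (x a) b * scl H (counit H c) d) =
       Lx f * (\<Sum>(c, d)\<in>#comul H g. scl H (counit H c) d)"
      unfolding Lx_def case_prod_unfold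
      by (simp only: sum_mset_distrib_right) (simp only: sum_mset_distrib_left)
    finally show ?thesis by (simp only: c1)
  qed
  have Lx_1: "Lx 1 = 0"
    unfolding Lx_def
    using sum_tensor_eq[OF comul_1, of "\<lambda>a b. scl H (x a) b"]
    by (simp add: algebra_simps lie_zero[OF x] lie_one[OF x e1])
  \<comment> \<open>This is U + T; the goal amounts to its vanishing.\<close>
  define W where "W f = Lx (antip H f) + antip H (Rx f)" for f
  have W_add: "W (f + g) = W f + W g" and W_scl: "W (scl H r f) = scl H r (W f)" for f g r
    by (simp_all add: W_def Lx_add Rx_add Lx_scl Rx_scl algebra_simps)
  have W_conv: "(\<Sum>(a, b)\<in>#comul H f. W a * b) = 0" for f
  proof -
    have "0 = Lx (\<Sum>(a, b)\<in>#comul H f. antip H a * b)"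
      by (simp add: Sl Lx_scl Lx_1)
    also have "\<dots> = (\<Sum>(a, b)\<in>#comul H f. antip H a * Lx b) + (\<Sum>(a, b)\<in>#comul H f. Lx (antip H a) * b)"
      by (simp add: additive_sum_mset[of Lx] Lx_add Lx_mult case_prod_unfold sum_mset.distrib)
    \<comment> \<open>In both sums \<open>x\<close> is evaluated on the middle leg of the iterated
      coproduct, so coassociativity identifies them.\<close>
    also have "(\<Sum>(a, b)\<in>#comul H f. antip H a * Lx b) = (\<Sum>(a, b)\<in>#comul H f. antip H (Rx a) * b)"
      using sum_tensor3_eq[OF coassoc[of f], of "\<lambda>a b c. scl H (x b) (antip H a * c)"]
      by (simp add: algebra_simps case_prod_unfold sum_mset_bind image_mset.compositionality comp_def Lx_def Rx_def sum_mset_distrib_left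
          sum_mset_distrib_right additive_sum_mset[of "antip H"])
    finally show ?thesis
      by (simp add: W_def algebra_simps case_prod_unfold sum_mset.distrib)
  qed
  \<comment> \<open>In the convolution product, W = W * (id * S) = (W * id) * S = 0.\<close>
  have "W f = W (\<Sum>(a, b)\<in>#comul H f. scl H (counit H b) a)"
    by (simp only: c2)
  also have "\<dots> = (\<Sum>(a, b)\<in>#comul H f. W a * scl H (counit H b) 1)"
    by (simp add: additive_sum_mset_pair[of W] W_add W_scl)
  also have "\<dots> = (\<Sum>(a, b)\<in>#comul H f. \<Sum>(b1, b2)\<in>#comul H b. W a * (b1 * antip H b2))"
    by (simp only: Sr[symmetric] case_prod_unfold sum_mset_distrib_left)
  also have "\<dots> = (\<Sum>(a, b)\<in>#comul H f. (\<Sum>(a1, a2)\<in>#comul H a. W a1 * a2) * antip H b)"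
    using sum_tensor3_eq[OF coassoc[of f], of "\<lambda>a b c. W a * (b * antip H c)"]
    by (simp add: distrib_left distrib_right W_add W_scl case_prod_unfold sum_mset_bind image_mset.compositionality comp_def sum_mset_distrib_right mult.assoc)
  also have "\<dots> = 0"
    using W_conv by (simp add: case_prod_unfold)
  finally have "- Lx (antip H f) = antip H (Rx f)"
    by (simp add: W_def eq_neg_iff_add_eq_0 neg_eq_iff_add_eq_0)
  \<comment> \<open>The sign is absorbed by replacing \<open>x\<close> with \<open>x\<close> after
    the antipode, by \<open>lie_antip\<close>.\<close>
  moreover have "- Lx (antip H f) = (\<Sum>(a, b)\<in>#comul H (antip H f). scl H (x (antip H a)) b)"
    by (simp add: Lx_def lie_antip[OF H x] additive_sum_mset_pair[of uminus])
  moreover have "antip H (Rx f) = (\<Sum>(a, b)\<in>#comul H f. scl H (x b) (antip H a))"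
    by (simp add: Rx_def additive_sum_mset_pair[of "antip H"])
  ultimately show ?thesis by simp
qed

section \<open>First-order deformations\<close>

lemma dual_num_simps [simp]:
  "body (x + y) = body x + body y" "infpart (x + y) = infpart x + infpart y"
  "body (x - y) = body x - body y" "infpart (x - y) = infpart x - infpart y"
  "body (x * y) = body x * body y" "infpart (x * y) = body x * infpart y + infpart x * body y"
  "body (- x) = - body x" "infpart (- x) = - infpart x"
  "body 0 = 0" "infpart 0 = 0" "body 1 = 1" "infpart 1 = 0" "body hbar = 0" "infpart hbar = 1"
  for x y :: "'k::comm_ring_1 dual_num"
  by (simp_all add: plus_dual_num_def minus_dual_num_def uminus_dual_num_def times_dual_num_def
      zero_dual_num_def one_dual_num_def hbar_def)

lemma dual_num_eq_iff: "x = y \<longleftrightarrow> body x = body y \<and> infpart x = infpart y"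
  by (auto intro: dual_num.expand)

text \<open>Flatness for the ideal generated by \<hbar> makes \<hbar> \<otimes> m zero. On this
  ideal \<open>infpart\<close> is linear over the base through \<open>body\<close>, so x \<otimes> m
  maps well to \<open>t (infpart x) (\<rho> m)\<close>, and \<hbar> \<otimes> m goes to
  \<open>\<rho> m\<close>.\<close>

lemma hbar_torsion:
  fixes s :: "'k::comm_ring_1 dual_num \<Rightarrow> 'm::ab_group_add \<Rightarrow> 'm" and t :: "'k \<Rightarrow> 'n::ab_group_add \<Rightarrow> 'n"
  assumes flat: "flat s" and red: "reduces_to UNIV s N t \<rho>" and t: "module t" and m: "s hbar m = 0"
  shows "\<rho> m = 0"
proof -
  interpret t: module t by (rule t)
  interpret r: module "(*) :: 'k dual_num \<Rightarrow> _"
    by unfold_locales (auto simp: algebra_simps)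
  let ?I = "{x :: 'k dual_num. body x = 0}"
  have I: "r.subspace ?I"
    by (simp add: r.subspace_def)
  have "tensor_eq ?I (*) UNIV s {#(hbar, m)#} {#}"
    using flat m unfolding flat_def by (elim allE[of _ ?I] impE[OF _ I] allE[of _ "{#(hbar, m)#}"]) (simp add: I)
  then have "(\<Sum>(x, m)\<in>#{#(hbar, m)#}. t (infpart x) (\<rho> m)) = (\<Sum>(x, m)\<in>#{#}. t (infpart x) (\<rho> m))"
    by (rule sum_tensor_eq)
      (use red in \<open>auto simp: reduces_to_def t.scale_left_distrib t.scale_right_distrib mult.commute\<close>)
  then show ?thesis by simp
qed

text \<open>The description of the bracket has a unique solution: other lifts change the commutator
  by \<hbar> times a sum of commutators, which vanish in the commutative O(X), and
  \<open>hbar_torsion\<close> makes division by \<hbar> unique modulo \<hbar>.\<close>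

lemma semiclassical_bracket_eq:
  assumes X: "quantizes_variety HG A G \<rho>G X \<rho>X" and c: "a * b - b * a = cscl A hbar c"
  shows "semiclassical_bracket A \<rho>X (\<rho>X a) (\<rho>X b) = \<rho>X c"
proof -
  have red: "reduces_to UNIV (cscl A) UNIV (cscl X) \<rho>X" and fl: "flat (cscl A)"
    and mult: "\<rho>X (y * z) = \<rho>X y * \<rho>X z" and add: "\<rho>X (y + z) = \<rho>X y + \<rho>X z"
    and mod: "module (cscl X)"
    and modA: "module (cscl A)"
    and scl: "cscl A s y * z = cscl A s (y * z)" "y * cscl A s z = cscl A s (y * z)" for y z s
    using X by (auto simp: quantizes_variety_def comod_alg_map_def comodule_algebra_def assoc_algebra_def)
  interpret A: module "cscl A" by (rule modA)
  have diff: "\<rho>X (y - z) = \<rho>X y - \<rho>X z" for y z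
    using add[of "y - z" z] by simp
  have lift: "\<exists>m. y = z + cscl A hbar m" if "\<rho>X y = \<rho>X z" for y z
  proof -
    have "{x \<in> UNIV. \<rho>X x = 0} = cscl A hbar ` UNIV" using red unfolding reduces_to_def by blast
    moreover have "\<rho>X (y - z) = 0" using that by (simp add: diff)
    ultimately have "y - z \<in> cscl A hbar ` UNIV" by blast
    then show ?thesis by (metis add.commute diff_add_cancel imageE)
  qed
  have "hbar * hbar = (0 :: 'a dual_num)" by (simp add: dual_num_eq_iff)
  then have hh: "cscl A hbar (cscl A hbar m) = 0" for m by simp
  show ?thesis
    unfolding semiclassical_bracket_def
  proof (rule the_equality)
    show "\<exists>a' b' c'. \<rho>X a' = \<rho>X a \<and> \<rho>X b' = \<rho>X b \<and> a' * b' - b' * a' = cscl A hbar c' \<and> \<rho>X c = \<rho>X c'"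
      using c by blast
  next
    fix v assume "\<exists>a' b' c'. \<rho>X a' = \<rho>X a \<and> \<rho>X b' = \<rho>X b \<and> a' * b' - b' * a' = cscl A hbar c' \<and> v = \<rho>X c'"
    then obtain a' b' c' where *: "\<rho>X a' = \<rho>X a" "\<rho>X b' = \<rho>X b"
      "a' * b' - b' * a' = cscl A hbar c'" "v = \<rho>X c'" by blast
    obtain m n where m: "a' = a + cscl A hbar m" and n: "b' = b + cscl A hbar n"
      using lift[OF *(1)] lift[OF *(2)] by blast
    \<comment> \<open>The first-order change of the commutator when \<open>a\<close> and
      \<open>b\<close> move by \<open>m\<close> and \<open>n\<close>.\<close>
    define q where "q = a * n - n * a + (m * b - b * m)"
    have "a' * b' - b' * a' = (a * b - b * a) + cscl A hbar q"
      unfolding q_def m n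
      by (simp only: distrib_left distrib_right scl hh A.scale_right_distrib A.scale_right_diff_distrib) simp
    then have "cscl A hbar c' = cscl A hbar (c + q)"
      by (simp add: *(3) c A.scale_right_distrib)
    then have "cscl A hbar (c' - (c + q)) = 0" by (simp add: A.scale_right_diff_distrib)
    then have "\<rho>X (c' - (c + q)) = 0" by (rule hbar_torsion[OF fl red mod])
    moreover have "\<rho>X q = 0" by (simp add: q_def add diff mult mult.commute)
    ultimately show "v = \<rho>X c" by (simp add: *(4) diff add)
  qed
qed

section \<open>Quantized Hopf algebras and linearized skew-pairings\<close>

lemma
  assumes "quantizes_hopf H C \<rho>"
  shows quantizes_hopf_add: "\<rho> (a + b) = \<rho> a + \<rho> b"
    and quantizes_hopf_scl: "\<rho> (scl H s a) = scl C (body s) (\<rho> a)"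
    and quantizes_hopf_mult: "\<rho> (a * b) = \<rho> a * \<rho> b"
    and quantizes_hopf_counit: "counit C (\<rho> a) = body (counit H a)"
    and quantizes_hopf_comul: "tensor_eq UNIV (scl C) UNIV (scl C) (comul C (\<rho> a))
        (\<Sum>(a, b)\<in>#comul H a. {#(\<rho> a, \<rho> b)#})"
    and quantizes_hopf_surj: "\<exists>a. x = \<rho> a"
    and quantizes_hopf_kernel: "\<rho> a = \<rho> b \<Longrightarrow> \<exists>m. a = b + scl H hbar m"
proof -
  have hom: "hopf_map body H C \<rho>" and red: "reduces_to UNIV (scl H) UNIV (scl C) \<rho>"
    using assms by (auto simp: quantizes_hopf_def)
  show add: "\<rho> (a + b) = \<rho> a + \<rho> b" for a b using hom by (simp add: hopf_map_def)
  show "\<rho> (scl H s a) = scl C (body s) (\<rho> a)" "\<rho> (a * b) = \<rho> a * \<rho> b"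
    "counit C (\<rho> a) = body (counit H a)"
    "tensor_eq UNIV (scl C) UNIV (scl C) (comul C (\<rho> a)) (\<Sum>(a, b)\<in>#comul H a. {#(\<rho> a, \<rho> b)#})"
    using hom by (simp_all add: hopf_map_def)
  have "range \<rho> = UNIV" and ker: "{x \<in> UNIV. \<rho> x = 0} = scl H hbar ` UNIV"
    using red unfolding reduces_to_def by blast+
  then show "\<exists>a. x = \<rho> a" by blast
  show "\<exists>m. a = b + scl H hbar m" if "\<rho> a = \<rho> b"
  proof -
    have "\<rho> (a - b) = 0" using add[of "a - b" b] that by simp
    then have "a - b \<in> scl H hbar ` UNIV" using ker by blast
    then show ?thesis by (metis add.commute diff_add_cancel imageE)
  qed
qed

text \<open>A common setting for both structures: it is interpreted once for \<open>R\<close> and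
  once for \<open>RG\<close>.\<close>

locale first_order_pairing =
  fixes P :: "('k::comm_ring_1 dual_num, 'p::ring_1) hopf" and C :: "('k, 'd::comm_ring_1) hopf"
    and \<rho> :: "'p \<Rightarrow> 'd"
    and H :: "('k dual_num, 'h::ring_1) hopf" and K :: "('k, 'g::comm_ring_1) hopf"
    and \<sigma> :: "'h \<Rightarrow> 'g"
    and R :: "'p \<Rightarrow> 'h \<Rightarrow> 'k dual_num"
  assumes P: "quantizes_hopf P C \<rho>" and H: "quantizes_hopf H K \<sigma>"
    and C: "hopf_algebra C" and K: "hopf_algebra K"
    and skew: "skew_pairing P H R"
    and body_R: "body (R a b) = counit C (\<rho> a) * counit K (\<sigma> b)"
begin

text \<open>This is \<hbar> times \<open>r\<close>, kept on the quantized algebras so that their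
  bilinearity applies directly.\<close>

definition N :: "'p \<Rightarrow> 'h \<Rightarrow> 'k dual_num" where
  "N a b = R a b - counit P a * counit H b"

abbreviation "r \<equiv> first_order P \<rho> H \<sigma> R"

lemma counit_add: "counit P (a + a') = counit P a + counit P a'" "counit H (b + b') = counit H b + counit H b'"
  and counit_scl: "counit P (scl P s a) = s * counit P a" "counit H (scl H s b) = s * counit H b"
  and counit_mult: "counit P (a * a') = counit P a * counit P a'" "counit H (b * b') = counit H b * counit H b'"
  and counit_left: "(\<Sum>(x, y)\<in>#comul P a. scl P (counit P x) y) = a" "(\<Sum>(x, y)\<in>#comul H b. scl H (counit H x) y) = b"
  and counit_right: "(\<Sum>(x, y)\<in>#comul P a. scl P (counit P y) x) = a" "(\<Sum>(x, y)\<in>#comul H b. scl H (counit H y) x) = b"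
  using P H by (auto simp: quantizes_hopf_def hopf_algebra_def module_hom_iff)

lemma R_add: "R (a + a') b = R a b + R a' b" "R a (b + b') = R a b + R a b'"
  and R_scl: "R (scl P s a) b = s * R a b" "R a (scl H s b) = s * R a b"
  and R_mult_left: "R (a * a') b = (\<Sum>(x, y)\<in>#comul H b. R a x * R a' y)"
  and R_mult_right: "R a (b * b') = (\<Sum>(x, y)\<in>#comul P a. R x b' * R y b)"
  using skew by (auto simp: skew_pairing_def module_hom_iff)

lemma N_add: "N (a + a') b = N a b + N a' b" "N a (b + b') = N a b + N a b'"
  and N_scl: "N (scl P s a) b = s * N a b" "N a (scl H s b) = s * N a b"
  by (simp_all add: N_def R_add R_scl counit_add counit_scl algebra_simps)

lemma body_N: "body (N a b) = 0"
  by (simp add: N_def body_R quantizes_hopf_counit[OF P] quantizes_hopf_counit[OF H])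

text \<open>Lifts differ by multiples of \<hbar>, and \<hbar> kills the values of \<open>N\<close>
  because their \<open>body\<close> is zero. Hence \<open>first_order\<close> is well
  defined.\<close>

lemma N_cong:
  assumes "\<rho> a = \<rho> a'" "\<sigma> b = \<sigma> b'"
  shows "N a b = N a' b'"
proof -
  have "hbar * N x y = 0" for x y
    by (simp add: dual_num_eq_iff body_N)
  moreover obtain m n where "a = a' + scl P hbar m" "b = b' + scl H hbar n"
    using quantizes_hopf_kernel[OF P assms(1)] quantizes_hopf_kernel[OF H assms(2)] by blast
  ultimately show ?thesis by (simp add: N_add N_scl)
qed

lemma r_eq: "r (\<rho> a) (\<sigma> b) = infpart (N a b)"
proof -
  have eq: "R a b = counit P a * counit H b + hbar * Dual t 0 \<longleftrightarrow> t = infpart (N a b)" for a b t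
    using body_N[of a b] by (auto simp: N_def dual_num_eq_iff)
  show ?thesis
    unfolding first_order_def eq using N_cong by (intro the_equality) metis+
qed

lemma R_eq: "R a b = counit P a * counit H b + Dual 0 (r (\<rho> a) (\<sigma> b))"
  using body_N[of a b] by (simp add: r_eq dual_num_eq_iff N_def)

text \<open>Substitute \<epsilon> \<otimes> \<epsilon> + \<open>N\<close> into the skew-pairing
  axiom: products of two values of \<open>N\<close> vanish, and the counit axioms collapse the
  remaining sums to a Leibniz rule.\<close>

lemma N_mult_left: "N (a * a') b = counit P a * N a' b + counit P a' * N a b"
proof -
  have NN: "N x y * N x' y' = 0" for x y x' y'
    by (simp add: dual_num_eq_iff body_N)
  have "R (a * a') b = (\<Sum>(x, y)\<in>#comul H b. counit P a * R a' (scl H (counit H x) y) +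
      counit P a' * N a (scl H (counit H y) x))"
    unfolding R_mult_left
  proof (intro sum_mset_pair_cong)
    fix x y
    have "R a x * R a' y = counit P a * counit H x * R a' y + N a x * (counit P a' * counit H y + N a' y)"
      by (simp add: N_def algebra_simps)
    then show "R a x * R a' y = counit P a * R a' (scl H (counit H x) y) +
      counit P a' * N a (scl H (counit H y) x)"
      by (simp add: R_scl N_scl distrib_left NN mult_ac)
  qed
  also have "\<dots> = counit P a * R a' (\<Sum>(x, y)\<in>#comul H b. scl H (counit H x) y) +
      counit P a' * N a (\<Sum>(x, y)\<in>#comul H b. scl H (counit H y) x)"
    by (simp add: additive_sum_mset[of "R a'"] additive_sum_mset[of "N a"] R_add N_add
        case_prod_unfold sum_mset.distrib sum_mset_distrib_left)
  finally show ?thesis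
    unfolding counit_left counit_right by (simp add: N_def counit_mult algebra_simps)
qed

text \<open>The axiom reverses the two factors here, but to first order the result is symmetric in
  them.\<close>

lemma N_mult_right: "N a (b * b') = counit H b * N a b' + counit H b' * N a b"
proof -
  have NN: "N x y * N x' y' = 0" for x y x' y'
    by (simp add: dual_num_eq_iff body_N)
  have "R a (b * b') = (\<Sum>(x, y)\<in>#comul P a. counit H b' * R (scl P (counit P x) y) b +
      counit H b * N (scl P (counit P y) x) b')"
    unfolding R_mult_right
  proof (intro sum_mset_pair_cong)
    fix x y
    have "R x b' * R y b = counit P x * counit H b' * R y b + N x b' * (counit P y * counit H b + N y b)"
      by (simp add: N_def algebra_simps)
    then show "R x b' * R y b = counit H b' * R (scl P (counit P x) y) b +
      counit H b * N (scl P (counit P y) x) b'"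
      by (simp add: R_scl N_scl distrib_left NN mult_ac)
  qed
  also have "\<dots> = counit H b' * R (\<Sum>(x, y)\<in>#comul P a. scl P (counit P x) y) b +
      counit H b * N (\<Sum>(x, y)\<in>#comul P a. scl P (counit P y) x) b'"
    by (simp add: additive_sum_mset[of "\<lambda>x. R x b"] additive_sum_mset[of "\<lambda>x. N x b'"] R_add N_add
        case_prod_unfold sum_mset.distrib sum_mset_distrib_left)
  finally show ?thesis
    unfolding counit_left counit_right by (simp add: N_def counit_mult algebra_simps)
qed

lemma r_left_lie: "(\<lambda>x. r x y) \<in> lie C"
proof -
  obtain b where y: "y = \<sigma> b" using quantizes_hopf_surj[OF H] by blast
  show ?thesis
  proof (rule lieI[OF module_scl[OF C]], unfold y)
    fix x x' s
    obtain a a' where x: "x = \<rho> a" "x' = \<rho> a'" using quantizes_hopf_surj[OF P] by metis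
    \<comment> \<open>A scalar of k is lifted to the constant dual number.\<close>
    have "scl C s x = \<rho> (scl P (Dual s 0) a)"
      by (simp add: x quantizes_hopf_scl[OF P])
    then show "r (scl C s x) (\<sigma> b) = s * r x (\<sigma> b)"
      by (simp add: x r_eq N_scl body_N)
    show "r (x + x') (\<sigma> b) = r x (\<sigma> b) + r x' (\<sigma> b)"
      by (simp add: x r_eq N_add flip: quantizes_hopf_add[OF P])
    show "r (x * x') (\<sigma> b) = counit C x * r x' (\<sigma> b) + r x (\<sigma> b) * counit C x'"
      by (simp add: x r_eq N_mult_left body_N quantizes_hopf_counit[OF P] mult.commute flip: quantizes_hopf_mult[OF P])
  qed
qed

lemma r_right_lie: "r x \<in> lie K"
proof -
  obtain a where x: "x = \<rho> a" using quantizes_hopf_surj[OF P] by blast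
  show ?thesis
  proof (rule lieI[OF module_scl[OF K]], unfold x)
    fix y y' s
    obtain b b' where y: "y = \<sigma> b" "y' = \<sigma> b'" using quantizes_hopf_surj[OF H] by metis
    have "scl K s y = \<sigma> (scl H (Dual s 0) b)"
      by (simp add: y quantizes_hopf_scl[OF H])
    then show "r (\<rho> a) (scl K s y) = s * r (\<rho> a) y"
      by (simp add: y r_eq N_scl body_N)
    show "r (\<rho> a) (y + y') = r (\<rho> a) y + r (\<rho> a) y'"
      by (simp add: y r_eq N_add flip: quantizes_hopf_add[OF H])
    show "r (\<rho> a) (y * y') = counit K y * r (\<rho> a) y' + r (\<rho> a) y * counit K y'"
      by (simp add: y r_eq N_mult_right body_N quantizes_hopf_counit[OF H] mult.commute flip: quantizes_hopf_mult[OF H])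
  qed
qed

end

section \<open>Dual bases and membership in tensor products\<close>

lemma dual_basis_dual_space:
  fixes E :: "('a \<Rightarrow> 'k::comm_ring_1) set"
  assumes E: "\<not> module.dependent fscale E" "module.span fscale E = L"
  shows "(\<lambda>x. dual_basis E e x) \<in> dual_space L"
proof (rule dual_spaceI)
  fix x y :: "'a \<Rightarrow> 'k" and s
  assume x: "x \<in> L"
  show "dual_basis E e (fscale s x) = s * dual_basis E e x"
    using fscale.representation_scale[OF E(1), of x s] x E(2) by (simp add: dual_basis_def)
  assume y: "y \<in> L"
  show "dual_basis E e (x + y) = dual_basis E e x + dual_basis E e y"
    using fscale.representation_add[OF E(1), of y x] x y E(2) by (simp add: dual_basis_def)
next
  fix x :: "'a \<Rightarrow> 'k" assume "x \<notin> L"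
  then show "dual_basis E e x = 0"
    using E(2) by (simp add: dual_basis_def fscale.representation_def)
qed

lemma sum_apply: "(\<Sum>e\<in>E. F e) a = (\<Sum>e\<in>E. F e a)"
  for F :: "'b \<Rightarrow> 'a \<Rightarrow> 'k::comm_monoid_add"
  by (induction E rule: infinite_finite_induct) auto

lemma dual_basis_expand:
  assumes E: "finite E" "\<not> module.dependent fscale E" "module.span fscale E = L" and x: "x \<in> L"
  shows "x a = (\<Sum>e\<in>E. dual_basis E e x * e a)"
proof -
  have "(\<Sum>e\<in>E. fscale (fscale.representation E x e) e) = x"
    using fscale.sum_representation_eq[of E x E] E x by blast
  then have "x a = (\<Sum>e\<in>E. fscale (fscale.representation E x e) e) a" by simp
  also have "\<dots> = (\<Sum>e\<in>E. fscale (fscale.representation E x e) e a)"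
    by (rule sum_apply)
  also have "\<dots> = (\<Sum>e\<in>E. dual_basis E e x * e a)"
    unfolding dual_basis_def by (intro sum.cong HOL.refl) (rule fun_cong[OF fscale_def])
  finally show ?thesis .
qed

text \<open>Expanding each slice of \<open>r\<close> in the finite basis writes \<open>r\<close> as
  the sum of e \<otimes> (contraction of \<open>r\<close> with the dual vector of e).\<close>

lemma tensor_forms_basis:
  assumes E: "finite E" "\<not> module.dependent fscale E" "module.span fscale E = L"
    and left: "\<And>b. (\<lambda>a. r a b) \<in> L"
    and right: "\<And>\<alpha>. \<alpha> \<in> dual_space L \<Longrightarrow> (\<lambda>b. \<alpha> (\<lambda>a. r a b)) \<in> M"
  shows "r \<in> tensor_forms L M"
proof -
  define u where "u = image_mset (\<lambda>e. (e, \<lambda>b. dual_basis E e (\<lambda>a. r a b))) (mset_set E)"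
  have "E \<subseteq> L" using E(3) fscale.span_superset by blast
  then have "set_mset u \<subseteq> L \<times> M"
    using E right[OF dual_basis_dual_space[OF E(2,3)]] by (auto simp: u_def)
  moreover have "form_of u = r"
  proof (intro ext)
    fix a b
    show "form_of u a b = r a b"
      using dual_basis_expand[OF E left[of b], of a]
      by (simp add: form_of_def u_def image_mset.compositionality comp_def sum_unfold_sum_mset mult.commute)
  qed
  ultimately show ?thesis by (auto simp: tensor_forms_def)
qed

text \<open>A covector is linear on the first-variable slices, which lie in \<open>lie C\<close>, so
  contracting with it preserves the derivation property in the second variable.\<close>

lemma (in first_order_pairing) r_tensor_forms:
  assumes E: "finite E" "\<not> module.dependent fscale E" "module.span fscale E = lie C"
  shows "r \<in> tensor_forms (lie C) (lie K)"
proof (rule tensor_forms_basis[OF E r_left_lie])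
  fix \<alpha> assume \<alpha>: "\<alpha> \<in> dual_space (lie C)"
  note sub = fscale.subspace_scale[OF subspace_lie[OF module_scl[OF C]]]
  show "(\<lambda>b. \<alpha> (\<lambda>a. r a b)) \<in> lie K"
  proof (rule lieI[OF module_scl[OF K]])
    fix b b' s
    have "(\<lambda>a. r a (b + b')) = (\<lambda>a. r a b) + (\<lambda>a. r a b')"
      by (simp add: fun_eq_iff lie_add[OF r_right_lie])
    then show "\<alpha> (\<lambda>a. r a (b + b')) = \<alpha> (\<lambda>a. r a b) + \<alpha> (\<lambda>a. r a b')"
      by (simp add: dual_space_add[OF \<alpha>] r_left_lie)
    have "(\<lambda>a. r a (scl K s b)) = fscale s (\<lambda>a. r a b)"
      by (simp add: fun_eq_iff lie_scl[OF r_right_lie] fscale_def)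
    then show "\<alpha> (\<lambda>a. r a (scl K s b)) = s * \<alpha> (\<lambda>a. r a b)"
      by (simp add: dual_space_fscale[OF \<alpha>] r_left_lie)
    have "(\<lambda>a. r a (b * b')) = fscale (counit K b) (\<lambda>a. r a b') + fscale (counit K b') (\<lambda>a. r a b)"
      by (simp add: fun_eq_iff lie_mult[OF r_right_lie] fscale_def mult.commute)
    then show "\<alpha> (\<lambda>a. r a (b * b')) = counit K b * \<alpha> (\<lambda>a. r a b') + \<alpha> (\<lambda>a. r a b) * counit K b'"
      by (simp add: dual_space_add[OF \<alpha>] sub r_left_lie dual_space_fscale[OF \<alpha>] mult.commute)
  qed
qed

section \<open>The moment map equation\<close>

text \<open>As \<open>\<rho>X\<close> intertwines the coactions, the classical action can be
  computed from the quantum coaction and then reduced.\<close>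

lemma inf_act_reduction:
  assumes X: "quantizes_variety HG A G \<rho>G X \<rho>X" and z: "z \<in> lie G"
  shows "inf_act X z (\<rho>X b) = (\<Sum>(b0, b1)\<in>#coact A b. cscl X (z (\<rho>G b1)) (\<rho>X b0))"
proof -
  have modX: "module (cscl X)" and carrX: "carr X = UNIV"
    and co: "tensor_eq (carr X) (cscl X) UNIV (scl G) (coact X (\<rho>X b)) (\<Sum>(a, h)\<in>#coact A b. {#(\<rho>X a, \<rho>G h)#})"
    using X by (auto simp: quantizes_variety_def comod_alg_map_def comodule_algebra_def assoc_algebra_def)
  interpret X: module "cscl X" by (rule modX)
  have "(\<Sum>(a, h)\<in>#coact X (\<rho>X b). cscl X (z h) a) =
      (\<Sum>(a, h)\<in>#(\<Sum>(a, h)\<in>#coact A b. {#(\<rho>X a, \<rho>G h)#}). cscl X (z h) a)"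
    by (rule sum_tensor_eq[OF co])
      (simp_all add: X.scale_left_distrib X.scale_right_distrib lie_add[OF z] lie_scl[OF z] mult.commute)
  then show ?thesis
    by (simp add: inf_act_def sum_mset_sum_mset_pair)
qed

text \<open>One antipode comes from the left translation coaction, the other from identifying the
  reduction of \<open>F\<close> with O(D/G). \<open>sum_comul_antip\<close> trades them for
  \<open>x\<close> evaluated on the second leg of the coproduct, which is the coaction of
  \<open>F\<close>.\<close>

lemma inf_act_fun_DG:
  assumes HD: "quantizes_hopf HD D \<rho>D" and D: "hopf_algebra D" and x: "x \<in> lie D"
    and Q: "left_translation_coaction D G p \<delta>Q" and F: "TR_unit_coaction HD HG ph \<delta>F"
    and f: "f \<in> carr (TR_unit HD HG ph \<delta>F)" "antip D (\<rho>D f) \<in> carr (fun_DG D G p \<delta>Q)"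
  shows "inf_act (fun_DG D G p \<delta>Q) x (antip D (\<rho>D f)) =
    (\<Sum>(a, b)\<in>#\<delta>F f. scl D (x (\<rho>D b)) (antip D (\<rho>D a)))"
proof -
  interpret D: module "scl D" by (rule module_scl[OF D])
  interpret S: module_hom "scl D" "scl D" "antip D"
    using D by (simp add: hopf_algebra_def)
  note [simp] = D.scale_left_distrib D.scale_right_distrib lie_add[OF x] lie_scl[OF x] lie_zero[OF x]
    S.add S.scale quantizes_hopf_add[OF HD] quantizes_hopf_scl[OF HD]
  have \<rho>0: "\<rho>D 0 = 0" using quantizes_hopf_add[OF HD, of 0 0] by simp
  have "tensor_eq UNIV (scl D) UNIV (scl D) (\<delta>Q (antip D (\<rho>D f)))
      (\<Sum>(a, b)\<in>#comul D (antip D (\<rho>D f)). {#(b, antip D a)#})"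
    using Q f(2) by (simp add: left_translation_coaction_def)
  then have "(\<Sum>(a, b)\<in>#\<delta>Q (antip D (\<rho>D f)). scl D (x b) a) =
      (\<Sum>(a, b)\<in>#(\<Sum>(a, b)\<in>#comul D (antip D (\<rho>D f)). {#(b, antip D a)#}). scl D (x b) a)"
    by (rule sum_tensor_eq) (simp_all add: mult.commute)
  also have "\<dots> = (\<Sum>(a, b)\<in>#comul D (antip D (\<rho>D f)). scl D (x (antip D a)) b)"
    by (simp add: sum_mset_sum_mset_pair)
  also have "\<dots> = (\<Sum>(a, b)\<in>#comul D (\<rho>D f). scl D (x b) (antip D a))"
    by (rule sum_comul_antip[OF D x])
  also have "\<dots> = (\<Sum>(a, b)\<in>#(\<Sum>(a, b)\<in>#comul HD f. {#(\<rho>D a, \<rho>D b)#}). scl D (x b) (antip D a))"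
    by (rule sum_tensor_eq[OF quantizes_hopf_comul[OF HD]]) (simp_all add: mult.commute)
  also have "\<dots> = (\<Sum>(a, b)\<in>#comul HD f. scl D (x (\<rho>D b)) (antip D (\<rho>D a)))"
    by (simp add: sum_mset_sum_mset_pair)
  also have "\<dots> = (\<Sum>(a, b)\<in>#\<delta>F f. scl D (x (\<rho>D b)) (antip D (\<rho>D a)))"
  proof (rule sum_tensor_eq[symmetric])
    show "tensor_eq UNIV (scl HD) UNIV (scl HD) (\<delta>F f) (comul HD f)"
      using F f(1) by (simp add: TR_unit_coaction_def)
  qed (simp_all add: \<rho>0 mult.commute)
  finally show ?thesis
    by (simp add: inf_act_def fun_DG_def)
qed

theorem theorem4p27:
  fixes D :: "('k::comm_ring_1, 'd::comm_ring_1) hopf"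
    and G :: "('k, 'g::comm_ring_1) hopf"
    and p :: "'d \<Rightarrow> 'g"
    and HD :: "('k dual_num, 'p::ring_1) hopf"
    and R :: "'p \<Rightarrow> 'p \<Rightarrow> 'k dual_num"
    and \<rho>D :: "'p \<Rightarrow> 'd"
    and HG :: "('k dual_num, 'h::ring_1) hopf"
    and ph :: "'p \<Rightarrow> 'h"
    and RG :: "'p \<Rightarrow> 'h \<Rightarrow> 'k dual_num"
    and \<rho>G :: "'h \<Rightarrow> 'g"
    and A :: "('k dual_num, 'h, 'a::ring) comod_alg"
    and X :: "('k, 'g, 'x::comm_ring) comod_alg"
    and \<rho>X :: "'a \<Rightarrow> 'x"
    and E :: "('d \<Rightarrow> 'k) set"
    and br :: "('d \<Rightarrow> 'k) set \<Rightarrow> 'x \<Rightarrow> 'x \<Rightarrow> 'x"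
    and \<delta>Q :: "'d \<Rightarrow> ('d \<times> 'd) multiset"
    and \<delta>F :: "'p \<Rightarrow> ('p \<times> 'p) multiset"
    and \<mu> :: "'d \<Rightarrow> 'x"
    and \<mu>h :: "'p \<Rightarrow> 'a"
  defines "c \<equiv> symmetric_part (first_order HD \<rho>D HD \<rho>D R)"
    and "rG \<equiv> first_order HD \<rho>D HG \<rho>G RG"
    and "Q \<equiv> fun_DG D G p \<delta>Q"
    and "F \<equiv> TR_unit HD HG ph \<delta>F"
  assumes basis: "finite E" "\<not> module.dependent fscale E" "module.span fscale E = lie D"
    and quant_D: "quantizes_group HD R D \<rho>D"
    and quant_G: "quantizes_subgroup HD R HG ph RG D \<rho>D G \<rho>G p"
    and pair: "group_pair D G p c"
    and quant_X: "quantizes_variety HG A G \<rho>G X \<rho>X"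
    and brackets: "bracket_family D G p c X br"
      "br (quantum_complement D G rG) = semiclassical_bracket A \<rho>X"
    and Q_coaction: "left_translation_coaction D G p \<delta>Q"
    and F_coaction: "TR_unit_coaction HD HG ph \<delta>F"
    and F_classical: "reduces_to (carr F) (scl HD) (carr Q) (scl D) (F_to_DG D \<rho>D)"
    and mu_equivariant: "comod_alg_map id G p Q X \<mu>"
    and mu_quantum: "quantum_moment_map HG ph RG F A \<mu>h"
    and mu_reduction: "\<forall>f\<in>carr F. \<rho>X (\<mu>h f) = \<mu> (F_to_DG D \<rho>D f)"
  shows "classical_moment_map D G p c E Q X br \<mu>"
proof -
  have HD: "quantizes_hopf HD D \<rho>D" and cqt: "skew_pairing HD HD R"
    and body_R: "\<And>a b. body (R a b) = counit D (\<rho>D a) * counit D (\<rho>D b)"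
    using quant_D by (auto simp: quantizes_group_def coquasitriangular_def)
  have HG: "quantizes_hopf HG G \<rho>G" and ph: "hopf_map id HD HG ph" and skewG: "skew_pairing HD HG RG"
    and RG_ph: "\<And>a b. RG a (ph b) = R a b" and \<rho>_ph: "\<And>a. \<rho>G (ph a) = p (\<rho>D a)"
    and body_RG: "\<And>a b. body (RG a b) = counit D (\<rho>D a) * counit G (\<rho>G b)"
    using quant_G by (auto simp: quantizes_subgroup_def rel_coquasitriangular_def)
  have D: "hopf_algebra D" and G: "hopf_algebra G"
    using pair by (auto simp: group_pair_def closed_subgroup_def affine_algebraic_group_def)
  interpret RD: first_order_pairing HD D \<rho>D HD D \<rho>D R
    by unfold_locales (fact HD D cqt body_R)+
  interpret RG: first_order_pairing HD D \<rho>D HG G \<rho>G RG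
    by unfold_locales (fact HD HG D G skewG body_RG)+
  have counit_ph: "counit HG (ph b) = counit HD b" for b
    using ph by (simp add: hopf_map_def)
  \<comment> \<open>Compatibility of \<open>RG\<close> with \<open>R\<close> along \<open>ph\<close>
    descends to first order; it expresses \<open>c\<close> through \<open>rG\<close>, as the locale
    requires.\<close>
  have rG_p: "rG x (p y) = RD.r x y" for x y
  proof -
    obtain a b where xy: "x = \<rho>D a" "y = \<rho>D b"
      using quantizes_hopf_surj[OF HD] by metis
    show ?thesis
      unfolding xy rG_def \<rho>_ph[symmetric] RG.r_eq RD.r_eq
      by (simp add: RG.N_def RD.N_def RG_ph counit_ph)
  qed
  interpret lagrangian_r_matrix D G p rG c
  proof
    show "group_pair D G p c" by (fact pair)
    show "rG \<in> tensor_forms (lie D) (lie G)"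
      unfolding rG_def by (rule RG.r_tensor_forms[OF basis])
    show "c a b = rG a (p b) + rG b (p a)" for a b
      by (simp add: c_def symmetric_part_def rG_p)
  qed
  have modX: "module (cscl X)" and modA: "module (cscl A)" and carrX: "carr X = UNIV" and carrA: "carr A = UNIV"
    and X_scl: "\<And>s y z. cscl X s y * z = cscl X s (y * z)" "\<And>s y z. y * cscl X s z = cscl X s (y * z)"
    and A_scl: "\<And>s y z. cscl A s y * z = cscl A s (y * z)" "\<And>s y z. y * cscl A s z = cscl A s (y * z)"
    and \<rho>X_add: "\<And>y z. \<rho>X (y + z) = \<rho>X y + \<rho>X z" and \<rho>X_mult: "\<And>y z. \<rho>X (y * z) = \<rho>X y * \<rho>X z"
    and \<rho>X_scl: "\<And>s y. \<rho>X (cscl A s y) = cscl X (body s) (\<rho>X y)"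
    and A_counit: "\<And>y. (\<Sum>(a, h)\<in>#coact A y. cscl A (counit HG h) a) = y"
    and \<rho>X_surj: "range \<rho>X = UNIV"
    using quant_X
    by (auto simp: quantizes_variety_def comod_alg_map_def comodule_algebra_def assoc_algebra_def
        right_comodule_def reduces_to_def)
  interpret X: module "cscl X" by (rule modX)
  interpret A: module "cscl A" by (rule modA)
  have F_scl: "cscl F = scl HD" and F_coact: "coact F = \<delta>F" and Q_scl: "cscl Q = scl D"
    by (simp_all add: F_def Q_def TR_unit_def fun_DG_def)
  have F_comod: "right_comodule HD (carr F) (scl HD) \<delta>F"
    using F_coaction F_scl F_coact
    by (simp add: TR_unit_coaction_def comodule_algebra_def F_def[symmetric])
  have subF: "module.subspace (scl HD) (carr F)" and modHD: "module (scl HD)"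
    and \<delta>F_carr: "\<And>f t. f \<in> carr F \<Longrightarrow> t \<in># \<delta>F f \<Longrightarrow> fst t \<in> carr F"
    and F_counit: "\<And>f. f \<in> carr F \<Longrightarrow> (\<Sum>(a, h)\<in>#\<delta>F f. scl HD (counit HD h) a) = f"
    using F_comod by (fastforce simp: right_comodule_def)+
  have subQ: "module.subspace (scl D) (carr Q)"
    using Q_coaction Q_scl
    by (simp add: left_translation_coaction_def comodule_algebra_def assoc_algebra_def Q_def[symmetric])
  have F_to_Q: "antip D (\<rho>D f) \<in> carr Q" if "f \<in> carr F" for f
    using F_classical that by (auto simp: reduces_to_def F_to_DG_def)
  have \<mu>h_add: "\<mu>h (f + g) = \<mu>h f + \<mu>h g" and \<mu>h_scl: "\<mu>h (scl HD s f) = cscl A s (\<mu>h f)"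
    if "f \<in> carr F" "g \<in> carr F" for f g s
    using mu_quantum that F_scl by (auto simp: quantum_moment_map_def comod_alg_map_def)
  have \<mu>_add: "\<mu> (f + g) = \<mu> f + \<mu> g" and \<mu>_scl: "\<mu> (scl D s f) = cscl X s (\<mu> f)"
    if "f \<in> carr Q" "g \<in> carr Q" for f g s
    using mu_equivariant that Q_scl by (auto simp: comod_alg_map_def)
  have E_lie: "e \<in> lie D" if "e \<in> E" for e
    using basis(3) fscale.span_superset that by blast
  have main: "semiclassical_bracket A \<rho>X (\<mu> f1) f2 =
      (\<Sum>e\<in>E. \<mu> (inf_act Q e f1) * inf_act X (proj_along D G p c hh (dual_basis E e)) f2)"
    if f1: "f1 \<in> carr Q" for f1 f2
  proof -
    \<comment> \<open>Surjectivity of the reduction of \<open>F\<close> supplies a quantum lift of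
      \<open>f1\<close>.\<close>
    obtain f where f: "f \<in> carr F" "f1 = antip D (\<rho>D f)"
    proof -
      have "F_to_DG D \<rho>D ` carr F = carr Q" using F_classical unfolding reduces_to_def by blast
      then show ?thesis using f1 that by (force simp: F_to_DG_def)
    qed
    obtain b where b: "f2 = \<rho>X b" using \<rho>X_surj by (metis UNIV_I imageE)
    \<comment> \<open>The quotient of the commutator by \<hbar>: the contribution of the first-order
      part of \<open>RG\<close>.\<close>
    define q where "q = (\<Sum>(a, h)\<in>#\<delta>F f. \<Sum>(b0, b1)\<in>#coact A b.
        cscl A (Dual (rG (\<rho>D h) (\<rho>G b1)) 0) (b0 * \<mu>h a))"
    have "\<mu>h f * b = (\<Sum>(a, h)\<in>#\<delta>F f. \<Sum>(b0, b1)\<in>#coact A b. cscl A (RG h b1) (b0 * \<mu>h a))"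
      using mu_quantum f(1) carrA by (simp add: quantum_moment_map_def F_coact)
    also have "\<dots> = (\<Sum>(a, h)\<in>#\<delta>F f. \<Sum>(b0, b1)\<in>#coact A b.
        cscl A (counit HG b1) b0 * cscl A (counit HD h) (\<mu>h a)
        + cscl A hbar (cscl A (Dual (rG (\<rho>D h) (\<rho>G b1)) 0) (b0 * \<mu>h a)))"
    proof (intro sum_mset_pair_cong)
      fix a h b0 b1
      have "Dual 0 t = hbar * Dual t 0" for t :: 'k by (simp add: dual_num_eq_iff)
      then show "cscl A (RG h b1) (b0 * \<mu>h a) =
        cscl A (counit HG b1) b0 * cscl A (counit HD h) (\<mu>h a)
        + cscl A hbar (cscl A (Dual (rG (\<rho>D h) (\<rho>G b1)) 0) (b0 * \<mu>h a))"
        by (simp add: RG.R_eq rG_def A_scl A.scale_left_distrib mult.commute)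
    qed
    \<comment> \<open>The \<epsilon> \<otimes> \<epsilon> part factors into two sums that the counit
      axioms of the comodules turn into \<open>b\<close> and \<open>\<mu>h f\<close>.\<close>
    also have "\<dots> = (\<Sum>(b0, b1)\<in>#coact A b. cscl A (counit HG b1) b0) *
        (\<Sum>(a, h)\<in>#\<delta>F f. cscl A (counit HD h) (\<mu>h a)) + cscl A hbar q"
      unfolding q_def case_prod_unfold additive_sum_mset[of "cscl A hbar", OF A.scale_right_distrib]
      by (simp add: sum_mset.distrib sum_mset_distrib_left sum_mset_distrib_right)
    also have "(\<Sum>(a, h)\<in>#\<delta>F f. cscl A (counit HD h) (\<mu>h a)) = \<mu>h (\<Sum>(a, h)\<in>#\<delta>F f. scl HD (counit HD h) a)"
    proof -
      have "scl HD (counit HD (snd t)) (fst t) \<in> carr F" if "t \<in># \<delta>F f" for t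
        using module.subspace_scale[OF modHD subF] \<delta>F_carr[OF f(1) that] by blast
      then have "\<mu>h (\<Sum>t\<in>#\<delta>F f. scl HD (counit HD (snd t)) (fst t)) =
          (\<Sum>t\<in>#\<delta>F f. \<mu>h (scl HD (counit HD (snd t)) (fst t)))"
        by (intro additive_on_sum_mset[OF modHD subF] \<mu>h_add)
      also have "\<dots> = (\<Sum>t\<in>#\<delta>F f. cscl A (counit HD (snd t)) (\<mu>h (fst t)))"
        using \<mu>h_scl \<delta>F_carr[OF f(1)] by (intro arg_cong[where f = sum_mset] image_mset_cong) blast
      finally show ?thesis by (simp add: case_prod_unfold)
    qed
    finally have "\<mu>h f * b - b * \<mu>h f = cscl A hbar q"
      by (simp add: A_counit F_counit[OF f(1)])
    then have "semiclassical_bracket A \<rho>X (\<rho>X (\<mu>h f)) (\<rho>X b) = \<rho>X q"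
      by (rule semiclassical_bracket_eq[OF quant_X])
    then have bracket: "semiclassical_bracket A \<rho>X (\<mu> f1) f2 = \<rho>X q"
      using mu_reduction f by (simp add: b F_to_DG_def)

    \<comment> \<open>For a term of the coaction of \<open>f\<close>, this is the reduction of
      \<open>\<mu>h\<close> at its first leg, which lies in \<open>F\<close>.\<close>
    define M where "M t = \<mu> (antip D (\<rho>D (fst t)))" for t :: "'p \<times> 'p"
    have \<rho>q: "\<rho>X q = (\<Sum>t\<in>#\<delta>F f. \<Sum>u\<in>#coact A b.
        cscl X (rG (\<rho>D (snd t)) (\<rho>G (snd u))) (\<rho>X (fst u) * M t))"
    proof -
      have "\<rho>X (\<mu>h (fst t)) = M t" if "t \<in># \<delta>F f" for t
        using mu_reduction \<delta>F_carr[OF f(1) that] by (simp add: M_def F_to_DG_def)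
      then show ?thesis
        unfolding q_def case_prod_unfold additive_sum_mset[of \<rho>X, OF \<rho>X_add] \<rho>X_scl \<rho>X_mult
        by (intro arg_cong[where f = sum_mset] image_mset_cong) simp
    qed
    have left: "\<mu> (inf_act Q e f1) = (\<Sum>t\<in>#\<delta>F f. cscl X (e (\<rho>D (snd t))) (M t))" if e: "e \<in> E" for e
    proof -
      have S: "antip D (\<rho>D (fst t)) \<in> carr Q" if "t \<in># \<delta>F f" for t
        using F_to_Q \<delta>F_carr[OF f(1) that] by blast
      have "inf_act Q e f1 = (\<Sum>t\<in>#\<delta>F f. scl D (e (\<rho>D (snd t))) (antip D (\<rho>D (fst t))))"
        using inf_act_fun_DG[OF HD D E_lie[OF e] Q_coaction F_coaction, of f] f F_to_Q[OF f(1)]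
        by (simp add: Q_def F_def case_prod_unfold)
      also have "\<mu> \<dots> = (\<Sum>t\<in>#\<delta>F f. \<mu> (scl D (e (\<rho>D (snd t))) (antip D (\<rho>D (fst t)))))"
        using S module.subspace_scale[OF module_D subQ]
        by (intro additive_on_sum_mset[OF module_D subQ] \<mu>_add) auto
      also have "\<dots> = (\<Sum>t\<in>#\<delta>F f. cscl X (e (\<rho>D (snd t))) (M t))"
        unfolding M_def using S \<mu>_scl by (intro arg_cong[where f = sum_mset] image_mset_cong) blast
      finally show ?thesis .
    qed
    have right: "inf_act X (proj_along D G p c hh (dual_basis E e)) f2 =
        (\<Sum>u\<in>#coact A b. cscl X (dual_basis E e (\<lambda>a. rG a (\<rho>G (snd u)))) (\<rho>X (fst u)))" for e
    proof -
      have d: "dual_basis E e \<in> dual_space (lie D)"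
        using dual_basis_dual_space[OF basis(2,3), of e] by simp
      have z: "(\<lambda>y. dual_basis E e (\<lambda>a. rG a y)) \<in> lie G"
        using r1_lie[OF d] by (simp add: r1_def)
      show ?thesis
        unfolding proj_along_hh[OF d] b inf_act_reduction[OF quant_X z] by (simp add: case_prod_unfold)
    qed
    have "(\<Sum>e\<in>E. \<mu> (inf_act Q e f1) * inf_act X (proj_along D G p c hh (dual_basis E e)) f2) =
      (\<Sum>e\<in>E. \<Sum>t\<in>#\<delta>F f. \<Sum>u\<in>#coact A b.
        cscl X (dual_basis E e (\<lambda>a. rG a (\<rho>G (snd u))) * e (\<rho>D (snd t))) (\<rho>X (fst u) * M t))"
    proof (intro sum.cong HOL.refl)
      fix e assume e: "e \<in> E"
      show "\<mu> (inf_act Q e f1) * inf_act X (proj_along D G p c hh (dual_basis E e)) f2 =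
        (\<Sum>t\<in>#\<delta>F f. \<Sum>u\<in>#coact A b.
          cscl X (dual_basis E e (\<lambda>a. rG a (\<rho>G (snd u))) * e (\<rho>D (snd t))) (\<rho>X (fst u) * M t))"
        unfolding left[OF e] right sum_mset_distrib_right
        unfolding sum_mset_distrib_left
        by (simp add: X_scl mult.commute)
    qed
    \<comment> \<open>With the basis sum innermost, the expansion of a slice of \<open>rG\<close> in
      the basis of \<dd> reassembles the values of \<open>rG\<close> in
      \<open>\<rho>q\<close>.\<close>
    also have "\<dots> = (\<Sum>t\<in>#\<delta>F f. \<Sum>u\<in>#coact A b. \<Sum>e\<in>E.
        cscl X (dual_basis E e (\<lambda>a. rG a (\<rho>G (snd u))) * e (\<rho>D (snd t))) (\<rho>X (fst u) * M t))"
      by (simp add: sum_sum_mset_swap)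
    also have "\<dots> = \<rho>X q"
      unfolding \<rho>q X.scale_sum_left[symmetric]
        dual_basis_expand[OF basis tensor_forms_left[OF r_tensor subspace_D], symmetric] ..
    finally show ?thesis using bracket by simp
  qed
  show ?thesis
    unfolding classical_moment_map_def
  \<comment> \<open>The witness is the complement whose bracket is, by assumption, the semiclassical
    one.\<close>
  proof (intro conjI exI[of _ hh] ballI)
    show "comod_alg_map id G p Q X \<mu>" by (fact mu_equivariant)
    show "lagrangian_complement D G p c hh" by (fact lagrangian_complement_hh)
    show "br hh (\<mu> f1) f2 =
        (\<Sum>e\<in>E. \<mu> (inf_act Q e f1) * inf_act X (proj_along D G p c hh (dual_basis E e)) f2)"
      if "f1 \<in> carr Q" for f1 f2
      using main[OF that] brackets(2) by simp
  qed
qed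

end
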